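(* Let $\Omega$ be a countably infinite set, $S=\mathrm{Sym}(\Omega)$, and let $G$ be a closed subgroup of $S$. Then $G\approx S$ (i.e., there is a finite set $U\subseteq S$ with $\langle G\cup U\rangle=S$) if and only if for every finite subset $\Gamma\subseteq\Omega$, the subgroup $G_{(\Gamma)}$ has at least one infinite orbit in $\Omega$.
   Context: $\mathrm{Sym}(\Omega)$ is the group of all permutations of $\Omega$, written to the right of their arguments. $S$ carries the function topology (pointwise convergence, $\Omega$ discrete), a subbasis of open sets being $\{f\in S:\alpha f=\beta\}$ for $\alpha,\beta\in\Omega$; "closed" means closed in $S$ in this topology. For $G\le S$ and $\Gamma\subseteq\Omega$, $G_{(\Gamma)}=\{g\in G:\gamma g=\gamma\ \forall\gamma\in\Gamma\}$. For subgroups $G_1,G_2\le S$, $G_1\preccurlyeq G_2$ means there is a finite $U\subseteq S$ with $G_1\le\langle G_2\cup U\rangle$, and $G_1\approx G_2$ means $G_1\preccurlyeq G_2$ and $G_2\preccurlyeq G_1$. *)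

theory Defs
  imports "HOL-Analysis.Analysis"
begin

text \<open>Sym(Omega), with Omega the universe of the type 'a. Permutations are bijections.
  The product convention (action on the right) does not affect generated subgroups.\<close>
definition Sym :: "('a \<Rightarrow> 'a) set" where
  "Sym = {f. bij f}"

definition sym_topology :: "('a \<Rightarrow> 'a) topology" where
  "sym_topology = topology_generated_by {{f \<in> Sym. f \<alpha> = \<beta>} | \<alpha> \<beta>. True}"

definition sym_closed :: "('a \<Rightarrow> 'a) set \<Rightarrow> bool" where
  "sym_closed G \<longleftrightarrow> closedin sym_topology G"

definition is_sym_subgroup :: "('a \<Rightarrow> 'a) set \<Rightarrow> bool" where
  "is_sym_subgroup H \<longleftrightarrow> H \<subseteq> Sym \<and> id \<in> H \<and>
     (\<forall>f\<in>H. \<forall>g\<in>H. g \<circ> f \<in> H) \<and> (\<forall>f\<in>H. inv f \<in> H)"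

definition gen_subgroup :: "('a \<Rightarrow> 'a) set \<Rightarrow> ('a \<Rightarrow> 'a) set" where
  "gen_subgroup X = \<Inter>{H. is_sym_subgroup H \<and> X \<subseteq> H}"

definition sym_preceq :: "('a \<Rightarrow> 'a) set \<Rightarrow> ('a \<Rightarrow> 'a) set \<Rightarrow> bool" where
  "sym_preceq G1 G2 \<longleftrightarrow> (\<exists>U. finite U \<and> U \<subseteq> Sym \<and> G1 \<subseteq> gen_subgroup (G2 \<union> U))"

definition sym_approx :: "('a \<Rightarrow> 'a) set \<Rightarrow> ('a \<Rightarrow> 'a) set \<Rightarrow> bool" where
  "sym_approx G1 G2 \<longleftrightarrow> sym_preceq G1 G2 \<and> sym_preceq G2 G1"

definition pstab :: "('a \<Rightarrow> 'a) set \<Rightarrow> 'a set \<Rightarrow> ('a \<Rightarrow> 'a) set" where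
  "pstab G \<Gamma> = {g \<in> G. \<forall>\<gamma>\<in>\<Gamma>. g \<gamma> = \<gamma>}"

definition orbit :: "('a \<Rightarrow> 'a) set \<Rightarrow> 'a \<Rightarrow> 'a set" where
  "orbit H \<alpha> = {h \<alpha> | h. h \<in> H}"

end

theory Submission
  imports Defs
begin

text \<open>
  If all orbits of \<open>G\<^sub>(\<^sub>\<Gamma>\<^sub>)\<close> are finite, then \<open>G \<union> U\<close> is contained in a group generated by
  \<open>G\<^sub>(\<^sub>\<Gamma>\<^sub>)\<close> and countably many elements, hence in a countable union of sets \<open>T\<^sub>i\<close> (one for each shape
  of words) under which every point has finitely many images. A product of disjoint transpositions
  \<open>(\<alpha>\<^sub>i \<beta>\<^sub>i)\<close> with \<open>\<beta>\<^sub>i \<notin> \<alpha>\<^sub>i T\<^sub>i\<close> lies outside this union.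

  Conversely, let \<open>f\<close> be a permutation of the natural numbers with infinitely many invariant initial
  segments. The finite pieces of all such \<open>f\<close> are the nodes \<open>c\<close> of a tree with finitely many nodes
  of each length \<open>e\<close>. One chooses finite sets \<open>\<Gamma>\<^sub>e\<close>, points \<open>\<alpha>\<^sub>e\<close> with infinite orbit under
  \<open>G\<^sub>(\<^sub>\<Gamma>\<^sub>)\<close> for \<open>\<Gamma> = \<Gamma>\<^sub>e\<close>, and \<open>p\<^sub>c \<in> G\<close> extending the choice at the parent of \<open>c\<close>, so that all the
  values \<open>p\<^sub>c(\<alpha>\<^sub>n)\<close>, \<open>n\<close> in the last block of \<open>c\<close>, are distinct and so that the \<open>p\<^sub>c\<close> along a branch
  converge to a bijection \<open>g \<in> G\<close>. A single permutation \<open>W\<close> acts on these values as each \<open>c\<close> prescribes,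
  and \<open>g\<^sup>-\<^sup>1 W g\<close> maps \<open>\<alpha>\<^sub>n\<close> to \<open>\<alpha>\<^sub>f\<^sub>(\<^sub>n\<^sub>)\<close>. As every permutation of the natural numbers is a product of two
  such \<open>f\<close>, the group generated by \<open>G\<close> and \<open>W\<close> induces the full symmetric group on the set of the
  \<open>\<alpha>\<^sub>n\<close>, and finitely many further permutations suffice to generate \<open>Sym\<close>.
\<close>

subsection \<open>Subgroups of the symmetric group\<close>

lemma sym_subgroupD:
  assumes "is_sym_subgroup H"
  shows "f \<in> H \<Longrightarrow> bij f" "id \<in> H"
    "f \<in> H \<Longrightarrow> g \<in> H \<Longrightarrow> f \<circ> g \<in> H" "f \<in> H \<Longrightarrow> inv f \<in> H"
  using assms unfolding is_sym_subgroup_def Sym_def by auto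

lemma is_sym_subgroup_Sym: "is_sym_subgroup Sym"
  unfolding is_sym_subgroup_def Sym_def by (auto simp: bij_comp bij_imp_bij_inv)

lemma gen_subgroup_least: "is_sym_subgroup H \<Longrightarrow> X \<subseteq> H \<Longrightarrow> gen_subgroup X \<subseteq> H"
  unfolding gen_subgroup_def by blast

lemma gen_subgroup_superset: "X \<subseteq> gen_subgroup X"
  unfolding gen_subgroup_def by blast

lemma is_sym_subgroup_gen_subgroup:
  assumes "X \<subseteq> Sym"
  shows "is_sym_subgroup (gen_subgroup X)"
proof -
  have "gen_subgroup X \<subseteq> Sym"
    using gen_subgroup_least[OF is_sym_subgroup_Sym assms] .
  then show ?thesis
    unfolding is_sym_subgroup_def gen_subgroup_def by blast
qed

lemma is_sym_subgroup_pstab: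
  assumes "is_sym_subgroup G"
  shows "is_sym_subgroup (pstab G \<Gamma>)"
proof -
  have "inv g \<gamma> = \<gamma>" if "g \<in> pstab G \<Gamma>" "\<gamma> \<in> \<Gamma>" for g \<gamma>
    using that sym_subgroupD(1)[OF assms] unfolding pstab_def
    by (metis (mono_tags, lifting) bij_inv_eq_iff mem_Collect_eq)
  then show ?thesis
    using assms unfolding is_sym_subgroup_def pstab_def by auto
qed

subsection \<open>Constructing permutations\<close>

lemma ex_swap_sequences:
  fixes \<alpha> \<beta> :: "'i \<Rightarrow> 'a"
  assumes "inj \<alpha>" "inj \<beta>" "range \<alpha> \<inter> range \<beta> = {}"
  shows "\<exists>u. bij u \<and> (\<forall>n. u (\<alpha> n) = \<beta> n) \<and> (\<forall>n. u (\<beta> n) = \<alpha> n) \<and>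
    (\<forall>x. x \<notin> range \<alpha> \<longrightarrow> x \<notin> range \<beta> \<longrightarrow> u x = x)"
proof -
  define u where "u x = (if x \<in> range \<alpha> then \<beta> (inv \<alpha> x)
    else if x \<in> range \<beta> then \<alpha> (inv \<beta> x) else x)" for x
  have a: "u (\<alpha> n) = \<beta> n" for n using assms by (simp add: u_def)
  have b: "u (\<beta> n) = \<alpha> n" for n using assms by (auto simp: u_def)
  have c: "u x = x" if "x \<notin> range \<alpha>" "x \<notin> range \<beta>" for x
    using that by (simp add: u_def)
  have "u (u x) = x" for x
    using a b c by (cases "x \<in> range \<alpha>"; cases "x \<in> range \<beta>") auto
  then have "bij u" by (intro involuntory_imp_bij) auto
  with a b c show ?thesis by blast
qed

lemma ex_swap_sets:
  fixes A B :: "'a set"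
  assumes "countable (UNIV :: 'a set)" "infinite A" "infinite B" "A \<inter> B = {}"
  shows "\<exists>u. bij u \<and> u ` A = B \<and> u ` B = A \<and> (\<forall>x. x \<notin> A \<longrightarrow> x \<notin> B \<longrightarrow> u x = x)"
proof -
  have cA: "countable A" and cB: "countable B"
    by (rule countable_subset[OF subset_UNIV assms(1)])+
  note a = bij_betw_from_nat_into[OF cA assms(2)] and b = bij_betw_from_nat_into[OF cB assms(3)]
  let ?a = "from_nat_into A" and ?b = "from_nat_into B"
  have r: "range ?a = A" "range ?b = B" "inj ?a" "inj ?b"
    using a b by (simp_all add: bij_betw_def)
  from ex_swap_sequences[OF r(3,4)] r assms(4) obtain u where
    u: "bij u" "\<And>n. u (?a n) = ?b n" "\<And>n. u (?b n) = ?a n"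
      "\<forall>x. x \<notin> A \<longrightarrow> x \<notin> B \<longrightarrow> u x = x"
    by auto
  have "u ` range ?a = range ?b" "u ` range ?b = range ?a"
    using u(2,3) by (simp_all add: image_image)
  then have "u ` A = B" "u ` B = A" unfolding r(1,2) .
  with u(1,4) show ?thesis by blast
qed

text \<open>Bijections between fibres of the same colour glue together. The colours used below are
  membership pairs in \<open>mixing_in_subgroup\<close>, membership in \<open>A\<close> and
  \<open>A'\<close> in \<open>ex_mixing_factor\<close>, and first indices in
  \<open>ex_bij_chains\<close>.\<close>

lemma ex_bij_fibres:
  fixes col :: "'a \<Rightarrow> 'c" and col' :: "'b \<Rightarrow> 'c"
  assumes "\<And>c. \<exists>t. bij_betw t (col -` {c}) (col' -` {c})"
  shows "\<exists>t. bij t \<and> (\<forall>x. col' (t x) = col x)"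
proof -
  from assms obtain T where T: "\<And>c. bij_betw (T c) (col -` {c}) (col' -` {c})" by metis
  define t where "t x = T (col x) x" for x
  have col: "col' (t x) = col x" for x
    using bij_betwE[OF T[of "col x"]] by (auto simp: t_def)
  have "inj t"
  proof (rule injI)
    fix x y assume e: "t x = t y"
    then have "col x = col y" using col by metis
    with e show "x = y"
      using bij_betw_imp_inj_on[OF T[of "col x"]] by (auto simp: t_def inj_on_def)
  qed
  moreover have "y \<in> range t" for y
  proof -
    have "y \<in> T (col' y) ` (col -` {col' y})"
      using bij_betw_imp_surj_on[OF T[of "col' y"]] by auto
    then obtain x where "col x = col' y" "y = T (col' y) x" by auto
    then show ?thesis unfolding t_def by (intro range_eqI[of _ _ x]) simp
  qed
  ultimately have "bij t" by (auto simp: bij_def)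
  with col show ?thesis by blast
qed

lemma ex_bij_betw_infinite:
  fixes A :: "'a set" and B :: "'b set"
  assumes "countable A" "infinite A" "countable B" "infinite B"
  shows "\<exists>t. bij_betw t A B"
  using bij_betw_trans[OF to_nat_on_infinite[OF assms(1,2)] bij_betw_from_nat_into[OF assms(3,4)]]
  by blast

subsection \<open>Generating the symmetric group from a full moiety\<close>

lemma bij_preserving_in_subgroup:
  fixes A :: "'a set"
  assumes K: "is_sym_subgroup K"
    and A: "\<And>f. bij f \<Longrightarrow> (\<forall>x. x \<notin> A \<longrightarrow> f x = x) \<Longrightarrow> f \<in> K"
    and B: "\<And>f. bij f \<Longrightarrow> (\<forall>x. x \<in> A \<longrightarrow> f x = x) \<Longrightarrow> f \<in> K"
    and t: "bij t" "\<And>x. t x \<in> A \<longleftrightarrow> x \<in> A"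
  shows "t \<in> K"
proof -
  have part: "bij (\<lambda>x. if x \<in> C then t x else x)" if C: "\<And>x. t x \<in> C \<longleftrightarrow> x \<in> C" for C
  proof (rule o_bij)
    let ?s = "\<lambda>x. if x \<in> C then inv t x else x"
    have C': "inv t x \<in> C \<longleftrightarrow> x \<in> C" for x
      using C t(1) by (metis bij_inv_eq_iff)
    show "?s \<circ> (\<lambda>x. if x \<in> C then t x else x) = id"
      using C t(1) by (auto simp: fun_eq_iff bij_is_inj)
    show "(\<lambda>x. if x \<in> C then t x else x) \<circ> ?s = id"
      using C' t(1) by (auto simp: fun_eq_iff bij_is_surj surj_f_inv_f)
  qed
  let ?a = "\<lambda>x. if x \<in> A then t x else x" and ?b = "\<lambda>x. if x \<in> - A then t x else x"
  have "?a \<in> K" using part[of A] t(2) by (intro A) auto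
  moreover have "?b \<in> K" using part[of "- A"] t(2) by (intro B) auto
  moreover have "?a \<circ> ?b = t" using t(2) by (auto simp: fun_eq_iff)
  ultimately show ?thesis using sym_subgroupD(3)[OF K] by metis
qed

text \<open>\<open>i\<close> and \<open>j\<close> are truth values, so four sets are concerned. In a
  countable universe their sizes are the same for all mixing permutations, which is why one
  representative will do for all.\<close>

definition mixing :: "'a set \<Rightarrow> ('a \<Rightarrow> 'a) \<Rightarrow> bool" where
  "mixing A f \<longleftrightarrow> (\<forall>i j. infinite {x. (x \<in> A) = i \<and> (f x \<in> A) = j})"

text \<open>Two mixing permutations lie in the same double coset of \<open>Sym(A) \<times> Sym(-A)\<close>.\<close>

lemma mixing_in_subgroup:
  fixes A :: "'a set"
  assumes c: "countable (UNIV :: 'a set)" and K: "is_sym_subgroup K"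
    and A: "\<And>f. bij f \<Longrightarrow> (\<forall>x. x \<notin> A \<longrightarrow> f x = x) \<Longrightarrow> f \<in> K"
    and B: "\<And>f. bij f \<Longrightarrow> (\<forall>x. x \<in> A \<longrightarrow> f x = x) \<Longrightarrow> f \<in> K"
    and f0: "f0 \<in> K" "mixing A f0" and f: "bij f" "mixing A f"
  shows "f \<in> K"
proof -
  have bf0: "bij f0" using sym_subgroupD(1)[OF K f0(1)] .
  define col where "col g x = (x \<in> A, g x \<in> A)" for g :: "'a \<Rightarrow> 'a" and x
  have inf: "infinite (col g -` {k})" if "mixing A g" for g k
  proof -
    have "col g -` {k} = {x. (x \<in> A) = fst k \<and> (g x \<in> A) = snd k}"
      by (auto simp: col_def prod_eq_iff)
    then show ?thesis using that by (simp add: mixing_def)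
  qed
  have "\<exists>t. bij_betw t (col f -` {k}) (col f0 -` {k})" for k
    using inf f0 f by (intro ex_bij_betw_infinite countable_subset[OF _ c]) auto
  from ex_bij_fibres[of "col f" "col f0", OF this]
  obtain t where t: "bij t" "\<And>x. col f0 (t x) = col f x" by blast
  have tA: "t x \<in> A \<longleftrightarrow> x \<in> A" and tf: "f0 (t x) \<in> A \<longleftrightarrow> f x \<in> A" for x
    using t(2)[of x] by (auto simp: col_def)
  have "t \<in> K" by (rule bij_preserving_in_subgroup[OF K A B t(1) tA])
  \<comment> \<open>\<open>f0 (t x)\<close> and \<open>f x\<close> lie on the same side of
    \<open>A\<close>. Hence \<open>s\<close>, which sends the former to the latter, preserves
    \<open>A\<close>, as \<open>t\<close> does.\<close>
  define s where "s = f \<circ> inv t \<circ> inv f0"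
  have bs: "bij s" unfolding s_def using f t bf0 by (intro bij_comp bij_imp_bij_inv)
  have sf: "s \<circ> (f0 \<circ> t) = f"
    using t(1) bf0 by (auto simp: s_def fun_eq_iff bij_is_inj)
  have sA: "s x \<in> A \<longleftrightarrow> x \<in> A" for x
  proof -
    obtain y where x: "x = f0 (t y)" using t(1) bf0 by (metis bij_pointE)
    then have "s x = f y" using sf by (auto simp: fun_eq_iff)
    then show ?thesis using x tf by simp
  qed
  have "s \<in> K" by (rule bij_preserving_in_subgroup[OF K A B bs sA])
  with \<open>t \<in> K\<close> f0(1) show ?thesis using sf sym_subgroupD(3)[OF K] by metis
qed

text \<open>This writes \<open>f\<close> as \<open>(f \<circ> h) \<circ> inv h\<close>. The set
  \<open>A'\<close> halves every infinite cell of the partition by \<open>x \<in> A\<close> and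
  \<open>f x \<in> A\<close>, and \<open>h\<close> carries \<open>A\<close> to
  \<open>A'\<close>.\<close>

lemma ex_mixing_factor:
  fixes A :: "'a set"
  assumes c: "countable (UNIV :: 'a set)" and inf: "infinite A" "infinite (- A)" and f: "bij f"
  shows "\<exists>h. bij h \<and> mixing A h \<and> mixing A (f \<circ> h)"
proof -
  define C where "C k = {x. (x \<in> A) = fst k \<and> (f x \<in> A) = snd k}" for k
  have "\<exists>D\<subseteq>C k. infinite (C k) \<longrightarrow> infinite D \<and> infinite (C k - D)" for k
  proof (cases "finite (C k)")
    case False
    then obtain D E where "D \<subseteq> C k" "E \<subseteq> C k" "infinite D" "infinite E" "D \<inter> E = {}"
      by (rule infinite_split)
    moreover from this have "infinite (C k - D)"
      using infinite_super[of E "C k - D"] by blast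
    ultimately show ?thesis by blast
  qed auto
  then obtain D where D: "\<And>k. D k \<subseteq> C k"
    "\<And>k. infinite (C k) \<Longrightarrow> infinite (D k) \<and> infinite (C k - D k)" by metis
  define A' where "A' = (\<Union>k. D k)"
  have disj: "C k \<inter> D l = {}" if "k \<noteq> l" for k l
    using that D(1)[of l] by (auto simp: C_def prod_eq_iff)
  \<comment> \<open>\<open>P\<close> is a union of two cells, so one of them is infinite and is
    halved by \<open>A'\<close>.\<close>
  have split: "infinite (P \<inter> A')" "infinite (P - A')" if P: "P = C k \<union> C l" "infinite P" for P k l
  proof -
    obtain m where m: "infinite (C m)" "C m \<subseteq> P"
      using P by (metis finite_Un sup_ge1 sup_ge2)
    have "D m \<subseteq> P \<inter> A'" using m D(1)[of m] by (auto simp: A'_def)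
    then show "infinite (P \<inter> A')" using D(2)[OF m(1)] finite_subset by blast
    have "x \<notin> D l" if "x \<in> C m - D m" for x l
      using that disj[of m l] by (cases "l = m") auto
    then have "C m - D m \<subseteq> P - A'" using m unfolding A'_def by blast
    then show "infinite (P - A')" using D(2)[OF m(1)] finite_subset by blast
  qed
  have P1: "{x. (x \<in> A) = i} = C (i, True) \<union> C (i, False)" for i by (auto simp: C_def)
  have P2: "{x. (f x \<in> A) = i} = C (True, i) \<union> C (False, i)" for i by (auto simp: C_def)
  have infA: "infinite {x. (x \<in> A) = i}" for i
    using inf by (cases i) (auto simp: Compl_eq)
  have infB: "infinite {x. (f x \<in> A) = i}" for i
  proof -
    have "f ` {x. (f x \<in> A) = i} = {x. (x \<in> A) = i}"
      using bij_is_surj[OF f] by (auto simp: image_iff surj_def)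
    then show ?thesis using infA[of i] by (metis finite_imageI)
  qed
  have A'1: "infinite {x. (x \<in> A') = j \<and> (x \<in> A) = i}" for i j
    using split[OF P1 infA] by (cases j) (auto simp: Int_def set_diff_eq conj_commute)
  have A'2: "infinite {x. (x \<in> A') = j \<and> (f x \<in> A) = i}" for i j
    using split[OF P2 infB] by (cases j) (auto simp: Int_def set_diff_eq conj_commute)
  have "\<exists>t. bij_betw t ((\<lambda>x. x \<in> A) -` {i}) ((\<lambda>x. x \<in> A') -` {i})" for i
  proof (rule ex_bij_betw_infinite)
    show "infinite ((\<lambda>x. x \<in> A) -` {i})" using infA[of i] by (simp add: vimage_def)
    show "infinite ((\<lambda>x. x \<in> A') -` {i})"
      by (rule infinite_super[OF _ A'1[of i True]]) auto
  qed (auto intro: countable_subset[OF _ c])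
  from ex_bij_fibres[of "\<lambda>x. x \<in> A" "\<lambda>x. x \<in> A'", OF this]
  obtain h where h: "bij h" "\<And>x. h x \<in> A' \<longleftrightarrow> x \<in> A" by blast
  have "infinite {x. (x \<in> A) = i \<and> Q (h x)}" if "infinite {x. (x \<in> A') = i \<and> Q x}" for i Q
  proof -
    have "h ` {x. (x \<in> A) = i \<and> Q (h x)} = {x. (x \<in> A') = i \<and> Q x}"
    proof (intro set_eqI iffI)
      fix x assume x: "x \<in> {x. (x \<in> A') = i \<and> Q x}"
      obtain y where y: "x = h y" using h(1) by (metis bij_pointE)
      with x h(2) have "y \<in> {x. (x \<in> A) = i \<and> Q (h x)}" by simp
      with y show "x \<in> h ` {x. (x \<in> A) = i \<and> Q (h x)}" by blast
    next
      fix x assume "x \<in> h ` {x. (x \<in> A) = i \<and> Q (h x)}"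
      then obtain y where "x = h y" "(y \<in> A) = i" "Q (h y)" by blast
      with h(2)[of y] show "x \<in> {x. (x \<in> A') = i \<and> Q x}" by simp
    qed
    then show ?thesis using that by (metis finite_imageI)
  qed
  note this[OF A'1] this[OF A'2]
  then have "mixing A h" "mixing A (f \<circ> h)" by (simp_all add: mixing_def)
  with h(1) show ?thesis by blast
qed

text \<open>Nothing is known about the lifts \<open>q\<close> outside \<open>range \<alpha>\<close>.
  Commutators of lifts still give every permutation supported on a moiety \<open>A\<close>;
  \<open>v\<close> carries these over to \<open>- A\<close>, and the mixing \<open>f0\<close> then
  gives all of \<open>Sym\<close>.\<close>

lemma ex_generators_of_full_sequence:
  fixes \<alpha> :: "nat \<Rightarrow> 'a"
  assumes c: "countable (UNIV :: 'a set)" and \<alpha>: "inj \<alpha>"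
  shows "\<exists>U. finite U \<and> U \<subseteq> Sym \<and> (\<forall>K. is_sym_subgroup K \<longrightarrow> U \<subseteq> K \<longrightarrow>
    (\<forall>F. bij F \<longrightarrow> (\<exists>q\<in>K. \<forall>n. q (\<alpha> n) = \<alpha> (F n))) \<longrightarrow> K = Sym)"
proof -
  \<comment> \<open>The summand \<open>int \<times> nat\<close> provides copies of the naturals for
    a shift to move; the two summands \<open>nat\<close> make \<open>s2\<close> and \<open>r\<close>
    infinite.\<close>
  have "infinite (UNIV :: ((int \<times> nat) + (nat + nat)) set)"
    by (simp add: finite_Plus_UNIV_iff finite_prod)
  from ex_bij_betw_infinite[OF _ this _ infinite_UNIV_nat]
  obtain \<kappa> :: "(int \<times> nat) + (nat + nat) \<Rightarrow> nat" where \<kappa>: "bij \<kappa>" by auto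
  define \<iota> where "\<iota> = \<alpha> \<circ> \<kappa>"
  have \<iota>: "inj \<iota>" unfolding \<iota>_def using \<alpha> \<kappa> by (simp add: inj_compose bij_is_inj)
  define s1 where "s1 = \<iota> ` range Inl"
  define s2 where "s2 = range (\<lambda>n. \<iota> (Inr (Inl n)))"
  define r where "r = - s1 - s2"
  define A where "A = range (\<lambda>n. \<iota> (Inl (0, n)))"
  have disj: "s1 \<inter> s2 = {}" using \<iota> by (auto simp: s1_def s2_def dest: injD)
  have inf2: "infinite s2" unfolding s2_def
    using \<iota> by (intro range_inj_infinite) (auto simp: inj_on_def)
  have "infinite (range (\<lambda>n. \<iota> (Inr (Inr n))))"
    using \<iota> by (intro range_inj_infinite) (auto simp: inj_on_def)
  then have infr: "infinite r"
    by (rule infinite_super[rotated]) (use \<iota> in \<open>auto simp: r_def s1_def s2_def dest: injD\<close>)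
  have infA: "infinite A" unfolding A_def
    using \<iota> by (intro range_inj_infinite) (auto simp: inj_on_def)
  have As1: "A \<subseteq> s1" by (auto simp: A_def s1_def)
  have infB: "infinite (- A)"
    by (rule infinite_super[OF _ infr]) (use As1 in \<open>auto simp: r_def\<close>)
  obtain u where u: "bij u" "u ` s2 = r" "u ` r = s2" "\<And>x. x \<in> s1 \<Longrightarrow> u x = x"
  proof -
    have "s2 \<inter> r = {}" by (auto simp: r_def)
    from ex_swap_sets[OF c inf2 infr this] obtain u where
      "bij u" "u ` s2 = r" "u ` r = s2" "\<forall>x. x \<notin> s2 \<longrightarrow> x \<notin> r \<longrightarrow> u x = x" by blast
    then show thesis using disj by (intro that[of u]) (auto simp: r_def)
  qed
  obtain v where v: "bij v" "v ` A = - A" "v ` (- A) = A"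
    using ex_swap_sets[OF c infA infB] by auto
  \<comment> \<open>Factoring the identity merely supplies some mixing permutation.\<close>
  obtain f0 where f0: "bij f0" "mixing A f0"
    using ex_mixing_factor[OF c infA infB bij_id] by blast
  have "K = Sym" if K: "is_sym_subgroup K" and UK: "{u, v, f0} \<subseteq> K"
    and full: "\<And>F. bij F \<Longrightarrow> \<exists>q\<in>K. \<forall>n. q (\<alpha> n) = \<alpha> (F n)" for K
  proof -
    note Kc = sym_subgroupD(3)[OF K] and Ki = sym_subgroupD(4)[OF K] and Kb = sym_subgroupD(1)[OF K]
    have full1: "\<exists>q\<in>K. (\<forall>z. q (\<iota> (Inl z)) = \<iota> (Inl (\<phi> z))) \<and> (\<forall>x\<in>s2. q x = x)" if "bij \<phi>" for \<phi>
    proof -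
      have "bij (map_sum \<phi> id)"
      proof (rule o_bij)
        show "map_sum (inv \<phi>) id \<circ> map_sum \<phi> id = id" "map_sum \<phi> id \<circ> map_sum (inv \<phi>) id = id"
          using that by (auto simp: fun_eq_iff bij_is_inj bij_is_surj surj_f_inv_f map_sum.compositionality
            comp_def sum.map_ident)
      qed
      then have "bij (\<kappa> \<circ> map_sum \<phi> id \<circ> inv \<kappa>)"
        using \<kappa> by (intro bij_comp bij_imp_bij_inv)
      from full[OF this] obtain q where "q \<in> K" and
        q: "\<And>n. q (\<alpha> n) = \<alpha> (\<kappa> (map_sum \<phi> id (inv \<kappa> n)))" by auto
      have "q (\<iota> z) = \<iota> (map_sum \<phi> id z)" for z
        using q[of "\<kappa> z"] \<kappa> by (simp add: \<iota>_def bij_is_inj)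
      with \<open>q \<in> K\<close> show ?thesis by (intro bexI[of _ q]) (auto simp: s2_def)
    qed
    have onA: "\<exists>k\<in>K. (\<forall>n. k (\<iota> (Inl (0, n))) = \<iota> (Inl (0, F n))) \<and> (\<forall>x. x \<notin> A \<longrightarrow> k x = x)"
      if F: "bij F" for F
    proof -
      txt \<open>\<open>F\<close> on the copy of index 0 is the commutator of \<open>a\<close>, which is \<open>F\<close> on all copies of
        index at least 0, and the shift \<open>b\<close>. Conjugation by \<open>u\<close> makes the regions where the lifts of
        \<open>a\<close> and \<open>b\<close> are uncontrolled disjoint, so that the commutator of the lifts is trivial there.\<close>
      define a where "a z = (case z of (i :: int, n) \<Rightarrow> (i, if i \<ge> 0 then F n else n))" for z
      define a' where "a' z = (case z of (i :: int, n) \<Rightarrow> (i, if i \<ge> 0 then inv F n else n))" for z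
      define b where "b z = (case z of (i :: int, n :: nat) \<Rightarrow> (i + 1, n))" for z
      define b' where "b' z = (case z of (i :: int, n :: nat) \<Rightarrow> (i - 1, n))" for z
      have aa: "a (a' z) = z" "a' (a z) = z" for z
        using F by (auto simp: a_def a'_def bij_is_inj bij_is_surj surj_f_inv_f split: prod.split)
      have bb: "b (b' z) = z" "b' (b z) = z" for z
        by (auto simp: b_def b'_def split: prod.split)
      have "bij a" "bij b" using aa bb by (auto intro!: o_bij simp: fun_eq_iff)
      obtain p where p: "p \<in> K" "\<And>z. p (\<iota> (Inl z)) = \<iota> (Inl (a z))" "\<And>x. x \<in> s2 \<Longrightarrow> p x = x"
        using full1[OF \<open>bij a\<close>] by auto
      obtain q0 where q0: "q0 \<in> K" "\<And>z. q0 (\<iota> (Inl z)) = \<iota> (Inl (b z))" "\<And>x. x \<in> s2 \<Longrightarrow> q0 x = x"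
        using full1[OF \<open>bij b\<close>] by auto
      define q where "q = u \<circ> q0 \<circ> inv u"
      have uK: "u \<in> K" using UK by simp
      have qK: "q \<in> K" unfolding q_def by (intro Kc Ki uK q0)
      have inv_u: "inv u (u x) = x" for x using u(1) by (simp add: bij_is_inj)
      have q1: "q (\<iota> (Inl z)) = \<iota> (Inl (b z))" for z
      proof -
        have "inv u (\<iota> (Inl z)) = \<iota> (Inl z)"
          using inv_u[of "\<iota> (Inl z)"] u(4) by (simp add: s1_def)
        then show ?thesis using q0(2) u(4) by (simp add: q_def s1_def)
      qed
      have q2: "q x = x" if xr: "x \<in> r" for x
      proof -
        obtain y where "y \<in> s2" "x = u y" using u(2) xr by blast
        then show ?thesis using q0(3) inv_u by (simp add: q_def)
      qed
      have ip: "inv p y = x \<longleftrightarrow> y = p x" and iq: "inv q y = x \<longleftrightarrow> y = q x" for x y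
        using Kb[OF p(1)] Kb[OF qK] by (metis bij_inv_eq_iff)+
      have p1': "inv p (\<iota> (Inl z)) = \<iota> (Inl (a' z))" for z using p(2) aa by (simp add: ip)
      have q1': "inv q (\<iota> (Inl z)) = \<iota> (Inl (b' z))" for z using q1 bb by (simp add: iq)
      have ps1: "p x \<in> s1 \<longleftrightarrow> x \<in> s1" for x
      proof
        assume "p x \<in> s1"
        then obtain z where "p x = \<iota> (Inl z)" by (auto simp: s1_def)
        then have "x = inv p (\<iota> (Inl z))" using ip by metis
        then show "x \<in> s1" by (simp add: p1' s1_def)
      qed (use p(2) in \<open>auto simp: s1_def\<close>)
      have qs1: "q x \<in> s1 \<longleftrightarrow> x \<in> s1" for x
      proof
        assume "q x \<in> s1"
        then obtain z where "q x = \<iota> (Inl z)" by (auto simp: s1_def)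
        then have "x = inv q (\<iota> (Inl z))" using iq by metis
        then show "x \<in> s1" by (simp add: q1' s1_def)
      qed (use q1 in \<open>auto simp: s1_def\<close>)
      define k where "k = p \<circ> q \<circ> inv p \<circ> inv q"
      have "k \<in> K" unfolding k_def by (intro Kc Ki p qK)
      have k1: "k (\<iota> (Inl z)) = \<iota> (Inl (a (b (a' (b' z)))))" for z
        by (simp add: k_def p(2) q1 p1' q1')
      \<comment> \<open>Both \<open>p\<close> and \<open>q\<close> preserve \<open>s1\<close>. On
        the rest \<open>p\<close> can move only points of \<open>r\<close> and \<open>q\<close> only
        points of \<open>s2\<close>, so they commute there.\<close>
      have k2: "k x = x" if x: "x \<notin> s1" for x
      proof (cases "x \<in> s2")
        case True
        define y where "y = inv q x"
        have qy: "q y = x" using iq y_def by metis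
        have "y \<in> s2"
        proof (rule ccontr)
          assume "y \<notin> s2"
          moreover have "y \<notin> s1" using x qy qs1 by metis
          ultimately have "q y = y" by (intro q2) (simp add: r_def)
          with qy True \<open>y \<notin> s2\<close> show False by simp
        qed
        then have "inv p y = y" using p(3) ip by metis
        then show ?thesis using qy True p(3) by (simp add: k_def flip: y_def)
      next
        case False
        then have xr: "x \<in> r" using x by (simp add: r_def)
        then have "inv q x = x" using q2 iq by metis
        moreover define y where "y = inv p x"
        have py: "p y = x" using ip y_def by metis
        have "y \<notin> s1" using x py ps1 by metis
        moreover have "y \<notin> s2" using py p(3) False by metis
        ultimately show ?thesis using q2[of y] py by (simp add: k_def r_def flip: y_def)
      qed
      have "k x = x" if "x \<notin> A" for x
      proof (cases "x \<in> s1")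
        case True
        then obtain i n where x: "x = \<iota> (Inl (i, n))" by (auto simp: s1_def)
        with that have "i \<noteq> 0" by (auto simp: A_def)
        \<comment> \<open>For \<open>i > 0\<close> both \<open>inv F\<close> and \<open>F\<close>
          act and cancel; for \<open>i < 0\<close> neither acts. Only at \<open>i = 0\<close> does
          the shift separate them, leaving \<open>F\<close>.\<close>
        then have "a (b (a' (b' (i, n)))) = (i, n)"
          using F by (auto simp: a_def a'_def b_def b'_def bij_is_surj surj_f_inv_f)
        then show ?thesis using k1 x by simp
      qed (rule k2)
      moreover have "k (\<iota> (Inl (0, n))) = \<iota> (Inl (0, F n))" for n
        by (simp add: k1 a_def a'_def b_def b'_def)
      ultimately show ?thesis using \<open>k \<in> K\<close> by blast
    qed
    have suppA: "f \<in> K" if f: "bij f" "\<forall>x. x \<notin> A \<longrightarrow> f x = x" for f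
    proof -
      let ?j = "\<lambda>n. \<iota> (Inl (0, n))"
      have j: "bij_betw ?j UNIV A" unfolding A_def using \<iota> by (auto simp: bij_betw_def inj_on_def)
      have fA: "f ` A = A"
      proof -
        have "f ` (- A) = - A" using f(2) by (auto simp: image_iff)
        then show ?thesis using bij_image_Compl_eq[OF f(1), of A] by auto
      qed
      have "bij_betw f A A"
        using fA f(1) by (auto simp: bij_betw_def bij_is_inj intro: inj_on_subset)
      then have "bij (inv_into UNIV ?j \<circ> (f \<circ> ?j))"
        using j by (blast intro: bij_betw_trans bij_betw_inv_into)
      from onA[OF this] obtain k where k: "k \<in> K"
        "\<And>n. k (?j n) = ?j (inv_into UNIV ?j (f (?j n)))" "\<And>x. x \<notin> A \<Longrightarrow> k x = x" by auto
      have "k x = f x" for x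
      proof (cases "x \<in> A")
        case True
        then obtain n where x: "x = ?j n" by (auto simp: A_def)
        have "f (?j n) \<in> range ?j" using True x fA by (auto simp: A_def)
        then have "?j (inv_into UNIV ?j (f (?j n))) = f (?j n)" by (rule f_inv_into_f)
        then show ?thesis using k(2) x by simp
      qed (use k(3) f(2) in auto)
      then have "k = f" by auto
      with k(1) show ?thesis by simp
    qed
    have suppB: "f \<in> K" if f: "bij f" "\<forall>x. x \<in> A \<longrightarrow> f x = x" for f
    proof -
      have vK: "v \<in> K" using UK by simp
      have iv: "v (inv v x) = x" "inv v (v x) = x" for x
        using v(1) by (simp_all add: bij_is_inj bij_is_surj surj_f_inv_f)
      \<comment> \<open>\<open>v\<close> exchanges \<open>A\<close> and \<open>- A\<close>, so the
        conjugate is supported on \<open>A\<close>.\<close>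
      have "inv v \<circ> f \<circ> v \<in> K"
      proof (rule suppA)
        show "bij (inv v \<circ> f \<circ> v)" using f v by (intro bij_comp bij_imp_bij_inv)
        show "\<forall>x. x \<notin> A \<longrightarrow> (inv v \<circ> f \<circ> v) x = x"
          using f(2) v(3) iv by (metis ComplI comp_apply imageI)
      qed
      then have "v \<circ> (inv v \<circ> f \<circ> v) \<circ> inv v \<in> K" 
        using Kc[OF Kc[OF vK] Ki[OF vK]] by blast
      moreover have "v \<circ> (inv v \<circ> f \<circ> v) \<circ> inv v = f" using iv by (simp add: fun_eq_iff)
      ultimately show ?thesis by simp
    qed
    have "f \<in> K" if f: "bij f" for f
    proof -
      obtain h where h: "bij h" "mixing A h" "mixing A (f \<circ> h)"
        using ex_mixing_factor[OF c infA infB f] by blast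
      have f0K: "f0 \<in> K" using UK by simp
      note m = mixing_in_subgroup[OF c K suppA suppB f0K f0(2)]
      have "h \<in> K" "f \<circ> h \<in> K" using h f by (auto intro!: m bij_comp)
      then have "f \<circ> h \<circ> inv h \<in> K" using Kc Ki by blast
      moreover have "f \<circ> h \<circ> inv h = f"
        using h(1) by (simp add: fun_eq_iff bij_is_surj surj_f_inv_f)
      ultimately show ?thesis by simp
    qed
    then show ?thesis using K by (auto simp: is_sym_subgroup_def Sym_def)
  qed
  then show ?thesis using u(1) v(1) f0(1)
    by (intro exI[of _ "{u, v, f0}"]) (auto simp: Sym_def)
qed

subsection \<open>Countable unions of pointwise finite sets of permutations\<close>

text \<open>Words are grouped by shape, the list of sets from which their letters come. Pointwise
  finiteness passes from the sets to each shape, and there are only countably many shapes over a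
  countable stock of sets.\<close>

primrec word_set :: "('a \<Rightarrow> 'a) set list \<Rightarrow> ('a \<Rightarrow> 'a) set" where
  "word_set [] = {id}"
| "word_set (X # Xs) = {x \<circ> t | x t. x \<in> X \<and> t \<in> word_set Xs}"

lemma word_set_append:
  "f \<in> word_set Xs \<Longrightarrow> g \<in> word_set Ys \<Longrightarrow> f \<circ> g \<in> word_set (Xs @ Ys)"
proof (induction Xs arbitrary: f)
  case (Cons X Xs)
  then obtain x t where "f = x \<circ> t" "x \<in> X" "t \<in> word_set Xs" by auto
  moreover from this Cons have "t \<circ> g \<in> word_set (Xs @ Ys)" by blast
  moreover have "(x \<circ> t) \<circ> g = x \<circ> (t \<circ> g)" by (rule comp_assoc)
  ultimately show ?case unfolding append_Cons word_set.simps by blast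
qed simp

lemma word_set_inv:
  "\<forall>X\<in>set Xs. X \<subseteq> Sym \<Longrightarrow> f \<in> word_set Xs \<Longrightarrow>
    bij f \<and> inv f \<in> word_set (rev (map ((`) inv) Xs))"
proof (induction Xs arbitrary: f)
  case (Cons X Xs)
  then obtain x t where f: "f = x \<circ> t" and x: "x \<in> X" and t: "t \<in> word_set Xs" by auto
  have bx: "bij x" using x Cons.prems(1) by (auto simp: Sym_def)
  have bt: "bij t" and it: "inv t \<in> word_set (rev (map ((`) inv) Xs))"
    using Cons.IH[OF _ t] Cons.prems(1) by auto
  have "inv x = inv x \<circ> id" by simp
  then have "inv x \<in> word_set [inv ` X]" using x by auto
  from word_set_append[OF it this] show ?case
    unfolding f o_inv_distrib[OF bx bt] list.map rev.simps using bij_comp[OF bt bx] by blast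
qed simp

lemma finite_image_word_set:
  "\<forall>X\<in>set Xs. \<forall>\<alpha>. finite ((\<lambda>x. x \<alpha>) ` X) \<Longrightarrow> finite ((\<lambda>t. t \<alpha>) ` word_set Xs)"
proof (induction Xs)
  case (Cons X Xs)
  have "(\<lambda>t. t \<alpha>) ` word_set (X # Xs) \<subseteq> (\<Union>\<beta>\<in>(\<lambda>t. t \<alpha>) ` word_set Xs. (\<lambda>x. x \<beta>) ` X)"
    by auto
  moreover have "finite (\<Union>\<beta>\<in>(\<lambda>t. t \<alpha>) ` word_set Xs. (\<lambda>x. x \<beta>) ` X)"
    using Cons by (intro finite_UN_I) auto
  ultimately show ?case by (rule finite_subset)
qed simp

lemma is_sym_subgroup_words:
  assumes "\<And>X. X \<in> L \<Longrightarrow> X \<subseteq> Sym" "\<And>X. X \<in> L \<Longrightarrow> inv ` X \<in> L"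
  shows "is_sym_subgroup (\<Union>(word_set ` lists L))"
proof -
  let ?K = "\<Union>(word_set ` lists L)"
  have inv: "bij f" "inv f \<in> ?K" if "f \<in> ?K" for f
  proof -
    from that obtain Xs where Xs: "Xs \<in> lists L" "f \<in> word_set Xs" by blast
    moreover have "\<forall>X\<in>set Xs. X \<subseteq> Sym" using Xs assms(1) by auto
    moreover have "rev (map ((`) inv) Xs) \<in> lists L" using Xs assms(2) by auto
    ultimately show "bij f" "inv f \<in> ?K" using word_set_inv by blast+
  qed
  moreover have "g \<circ> f \<in> ?K" if "f \<in> ?K" "g \<in> ?K" for f g
  proof -
    from that obtain Xs Ys where "Xs \<in> lists L" "f \<in> word_set Xs"
      "Ys \<in> lists L" "g \<in> word_set Ys" by blast
    then show ?thesis using word_set_append by (intro UN_I[of "Ys @ Xs"]) auto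
  qed
  moreover have "id \<in> ?K" by (intro UN_I[of "[]"]) auto
  moreover have "?K \<subseteq> Sym" using inv(1) by (auto simp: Sym_def)
  ultimately show ?thesis unfolding is_sym_subgroup_def by simp
qed

lemma Sym_not_countable_union_pointwise_finite:
  fixes T :: "nat \<Rightarrow> ('a \<Rightarrow> 'a) set"
  assumes inf: "infinite (UNIV :: 'a set)" and fin: "\<And>n \<alpha>. finite ((\<lambda>t. t \<alpha>) ` T n)"
  shows "\<exists>f. bij f \<and> f \<notin> (\<Union>n. T n)"
proof -
  define P where "P h n r \<longleftrightarrow> fst r \<noteq> snd r \<and>
    {fst r, snd r} \<inter> (\<Union>m<n. {fst (h m), snd (h m)}) = {} \<and>
    snd r \<notin> (\<lambda>t. t (fst r)) ` T n" for h :: "nat \<Rightarrow> 'a \<times> 'a" and n r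
  have "\<exists>h. \<forall>n. P h n (h n)"
  proof (rule dependent_wellorder_choice)
    fix n and h :: "nat \<Rightarrow> 'a \<times> 'a"
    let ?X = "\<Union>m<n. {fst (h m), snd (h m)}"
    obtain a where a: "a \<notin> ?X" using ex_new_if_finite[OF inf, of ?X] by auto
    \<comment> \<open>Only finitely many values are forbidden: earlier pairs, \<open>a\<close>
      itself and the images of \<open>a\<close> under \<open>T n\<close>.\<close>
    obtain b where b: "b \<notin> insert a (?X \<union> (\<lambda>t. t a) ` T n)"
      using ex_new_if_finite[OF inf, of "insert a (?X \<union> (\<lambda>t. t a) ` T n)"] fin by auto
    from a b have "P h n (a, b)" by (auto simp: P_def)
    then show "\<exists>r. P h n r" ..
  qed (simp add: P_def)
  then obtain h where h: "\<And>n. P h n (h n)" by blast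
  define \<alpha> where "\<alpha> n = fst (h n)" for n
  define \<beta> where "\<beta> n = snd (h n)" for n
  have ne: "\<alpha> n \<noteq> \<beta> n" and new: "\<beta> n \<notin> (\<lambda>t. t (\<alpha> n)) ` T n" for n
    using h[of n] by (auto simp: P_def \<alpha>_def \<beta>_def)
  have lt: "{\<alpha> n, \<beta> n} \<inter> {\<alpha> m, \<beta> m} = {}" if "m < n" for m n
    using h[of n] that unfolding P_def \<alpha>_def \<beta>_def by blast
  have disj: "{\<alpha> n, \<beta> n} \<inter> {\<alpha> m, \<beta> m} = {}" if "m \<noteq> n" for m n
    using that lt[of m n] lt[of n m] by (cases "m < n") auto
  have "inj \<alpha>" "inj \<beta>" by (rule injI, use disj in blast)+
  moreover have "range \<alpha> \<inter> range \<beta> = {}"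
  proof -
    have "\<alpha> m \<noteq> \<beta> n" for m n using disj[of m n] ne[of m] by (cases "m = n") auto
    then show ?thesis by auto
  qed
  ultimately obtain u where u: "bij u" "\<And>n. u (\<alpha> n) = \<beta> n"
    using ex_swap_sequences[of \<alpha> \<beta>] by blast
  have "u \<notin> T n" for n using new[of n] u(2)[of n] by (auto simp: image_iff)
  with u(1) show ?thesis by blast
qed

section \<open>Stabilizers with finite orbits\<close>

lemma ex_countable_coset_representatives:
  fixes G :: "('a \<Rightarrow> 'a) set"
  assumes "countable (UNIV :: 'a set)" and G: "is_sym_subgroup G" and "finite \<Gamma>"
  shows "\<exists>C\<subseteq>G. countable C \<and> (\<forall>g\<in>G. \<exists>c\<in>C. \<exists>n\<in>pstab G \<Gamma>. g = c \<circ> n)"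
proof -
  obtain xs where xs: "set xs = \<Gamma>" using finite_list[OF \<open>finite \<Gamma>\<close>] by blast
  \<comment> \<open>Elements of \<open>G\<close> that agree on \<Gamma> lie in the same left coset
    of its stabilizer, so a coset is named by a finite list of points.\<close>
  define r where "r g = map g xs" for g :: "'a \<Rightarrow> 'a"
  define C where "C = inv_into G r ` (r ` G)"
  have "countable (r ` G)"
    using countable_lists[OF assms(1)] by (rule countable_subset[rotated]) auto
  then have "countable C" by (simp add: C_def)
  moreover have "C \<subseteq> G" by (auto simp: C_def inv_into_into)
  moreover have "\<exists>c\<in>C. \<exists>n\<in>pstab G \<Gamma>. g = c \<circ> n" if g: "g \<in> G" for g
  proof -
    define c where "c = inv_into G r (r g)"
    have c: "c \<in> G" "c \<in> C" "r c = r g"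
      using g by (auto simp: c_def C_def inv_into_into f_inv_into_f)
    have bc: "bij c" using sym_subgroupD(1)[OF G c(1)] .
    have "c \<gamma> = g \<gamma>" if "\<gamma> \<in> \<Gamma>" for \<gamma>
      using c(3) that xs by (auto simp: r_def)
    then have "(inv c \<circ> g) \<gamma> = \<gamma>" if "\<gamma> \<in> \<Gamma>" for \<gamma>
      using that bc by (metis bij_inv_eq_iff comp_apply)
    then have "inv c \<circ> g \<in> pstab G \<Gamma>"
      using sym_subgroupD(3,4)[OF G] c(1) g by (simp add: pstab_def)
    moreover have "g = c \<circ> (inv c \<circ> g)"
      using bc by (simp add: fun_eq_iff bij_is_surj surj_f_inv_f)
    ultimately show ?thesis using c(2) by blast
  qed
  ultimately show ?thesis by blast
qed

lemma finite_orbits_imp_not_preceq: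
  fixes G :: "('a \<Rightarrow> 'a) set"
  assumes c: "countable (UNIV :: 'a set)" and inf: "infinite (UNIV :: 'a set)"
    and G: "is_sym_subgroup G" and \<Gamma>: "finite \<Gamma>" "\<And>\<alpha>. finite (orbit (pstab G \<Gamma>) \<alpha>)"
  shows "\<not> sym_preceq Sym G"
proof
  assume "sym_preceq Sym G"
  then obtain U where U: "finite U" "U \<subseteq> Sym" "Sym \<subseteq> gen_subgroup (G \<union> U)"
    unfolding sym_preceq_def by blast
  obtain C where C: "C \<subseteq> G" "countable C" "\<And>g. g \<in> G \<Longrightarrow> \<exists>c\<in>C. \<exists>n\<in>pstab G \<Gamma>. g = c \<circ> n"
    using ex_countable_coset_representatives[OF c G \<Gamma>(1)] by blast
  let ?N = "pstab G \<Gamma>"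
  have N: "is_sym_subgroup ?N" by (rule is_sym_subgroup_pstab[OF G])
  have GS: "G \<subseteq> Sym" using G by (simp add: is_sym_subgroup_def)
  define D where "D = C \<union> U \<union> inv ` (C \<union> U)"
  have DS: "bij d" if "d \<in> D" for d
    using that C(1) GS U(2) by (auto simp: D_def Sym_def bij_imp_bij_inv)
  have Dinv: "inv d \<in> D" if "d \<in> D" for d
    using that C(1) GS U(2) by (auto simp: D_def Sym_def inv_inv_eq)
  \<comment> \<open>The stabilizer is a single letter set, pointwise finite because its orbits are
    finite; the countably many other generators enter as singletons.\<close>
  define L where "L = insert ?N ((\<lambda>d. {d}) ` D)"
  have cL: "countable (lists L)"
    using C(2) U(1) by (intro countable_lists) (auto simp: L_def D_def countable_finite)
  have N_inv: "inv ` ?N = ?N"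
  proof -
    have "inv (inv n) = n" if "n \<in> ?N" for n using sym_subgroupD(1)[OF N that] by (rule inv_inv_eq)
    then show ?thesis using sym_subgroupD(4)[OF N] by (force simp: image_iff)
  qed
  have K: "is_sym_subgroup (\<Union>(word_set ` lists L))"
  proof (rule is_sym_subgroup_words)
    show "X \<subseteq> Sym" if "X \<in> L" for X
      using that DS N by (auto simp: L_def Sym_def is_sym_subgroup_def)
    show "inv ` X \<in> L" if "X \<in> L" for X
      using that Dinv N_inv by (auto simp: L_def)
  qed
  have "G \<union> U \<subseteq> \<Union>(word_set ` lists L)"
  proof
    fix g assume "g \<in> G \<union> U"
    then consider c n where "c \<in> C" "n \<in> ?N" "g = c \<circ> n" | "g \<in> U" using C(3) by blast
    then show "g \<in> \<Union>(word_set ` lists L)"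
    proof cases
      case (1 c n)
      then have "g \<in> word_set [{c}, ?N]" by auto
      moreover have "[{c}, ?N] \<in> lists L" using 1 by (auto simp: L_def D_def)
      ultimately show ?thesis by blast
    next
      case 2
      then have "g \<in> word_set [{g}]" "[{g}] \<in> lists L" by (auto simp: L_def D_def)
      then show ?thesis by blast
    qed
  qed
  with K U(3) have "Sym \<subseteq> \<Union>(word_set ` lists L)" using gen_subgroup_least by blast
  moreover have "\<exists>f. bij f \<and> f \<notin> (\<Union>n. word_set (from_nat_into (lists L) n))"
  proof (rule Sym_not_countable_union_pointwise_finite[OF inf])
    fix n \<alpha>
    have "from_nat_into (lists L) n \<in> lists L" by (rule from_nat_into) auto
    moreover have "finite ((\<lambda>x. x \<beta>) ` X)" if "X \<in> L" for X \<beta>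
    proof -
      have "(\<lambda>x. x \<beta>) ` ?N = orbit ?N \<beta>" by (auto simp: orbit_def)
      then show ?thesis using that \<Gamma>(2) by (auto simp: L_def)
    qed
    ultimately show "finite ((\<lambda>t. t \<alpha>) ` word_set (from_nat_into (lists L) n))"
      by (intro finite_image_word_set) auto
  qed
  moreover have "range (from_nat_into (lists L)) = lists L"
    using cL by (intro range_from_nat_into) auto
  from this have "(\<Union>n. word_set (from_nat_into (lists L) n)) = \<Union>(word_set ` lists L)"
    by (metis image_image)
  ultimately show False unfolding Sym_def by auto
qed

subsection \<open>Factoring permutations of the natural numbers\<close>

text \<open>Colour each point by the first term of the chain that contains it. The fibres are the
  initial term and the differences of consecutive terms, finite and of equal size in both
  chains.\<close>

lemma ex_bij_chains:
  fixes S :: "nat \<Rightarrow> 'a set" and S' :: "nat \<Rightarrow> 'b set"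
  assumes S: "incseq S" "\<And>i. finite (S i)" "(\<Union>i. S i) = UNIV"
    and S': "incseq S'" "\<And>i. finite (S' i)" "(\<Union>i. S' i) = UNIV"
    and card: "\<And>i. card (S i) = card (S' i)"
  shows "\<exists>t. bij t \<and> (\<forall>i. t ` S i = S' i)"
proof -
  have fib: "(LEAST i. x \<in> T i) \<le> i \<longleftrightarrow> x \<in> T i" if "incseq T" "(\<Union>i. T i) = UNIV"
    for T :: "nat \<Rightarrow> 'c set" and x i
  proof
    assume le: "(LEAST i. x \<in> T i) \<le> i"
    have "\<exists>i. x \<in> T i" using that(2) by blast
    then have "x \<in> T (LEAST i. x \<in> T i)" by (rule LeastI_ex)
    then show "x \<in> T i" using incseqD[OF that(1) le] by blast
  qed (rule Least_le)
  define col where "col x = (LEAST i. x \<in> S i)" for x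
  define col' where "col' x = (LEAST i. x \<in> S' i)" for x
  have col: "col x \<le> i \<longleftrightarrow> x \<in> S i" and col': "col' y \<le> i \<longleftrightarrow> y \<in> S' i" for x y i
    unfolding col_def col'_def by (rule fib[OF S(1,3)], rule fib[OF S'(1,3)])
  have "\<exists>t. bij_betw t (col -` {i}) (col' -` {i})" for i
  proof (cases i)
    case 0
    have "col -` {i} = S 0" "col' -` {i} = S' 0"
      using col[of _ 0] col'[of _ 0] 0 by auto
    then show ?thesis using card S(2) S'(2) by (simp add: finite_same_card_bij)
  next
    case (Suc j)
    have eq: "k = Suc j \<longleftrightarrow> k \<le> Suc j \<and> \<not> k \<le> j" for k by auto
    have f: "col -` {i} = S (Suc j) - S j" "col' -` {i} = S' (Suc j) - S' j"
      unfolding Suc by (auto simp: eq col col')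
    have "S j \<subseteq> S (Suc j)" "S' j \<subseteq> S' (Suc j)" using S(1) S'(1) by (auto simp: incseq_Suc_iff)
    then have "card (S (Suc j) - S j) = card (S' (Suc j) - S' j)"
      using S(2) S'(2) card by (simp add: card_Diff_subset)
    then show ?thesis unfolding f using S(2) S'(2) by (simp add: finite_same_card_bij)
  qed
  from ex_bij_fibres[of col col', OF this] obtain t where
    t: "bij t" "\<And>x. col' (t x) = col x" by blast
  have "t ` S i = S' i" for i
  proof (intro set_eqI iffI)
    fix y assume y: "y \<in> S' i"
    obtain x where "y = t x" using t(1) by (metis bij_pointE)
    with y t(2)[of x] show "y \<in> t ` S i" by (metis col col' imageI)
  next
    fix y assume "y \<in> t ` S i"
    then show "y \<in> S' i" using t(2) by (metis col col' imageE)
  qed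
  with t(1) show ?thesis by blast
qed

definition blockwise :: "(nat \<Rightarrow> nat) \<Rightarrow> bool" where
  "blockwise f \<longleftrightarrow> bij f \<and> (\<forall>m. \<exists>a>m. f ` {..<a} = {..<a})"

text \<open>\<open>S\<close> consists of initial segments, while \<open>S'\<close> alternates
  initial segments with preimages of initial segments under \<open>F\<close>; \<open>a\<close> grows
  fast enough to make \<open>S'\<close> increasing. Terms of equal size yield \<open>t\<close>, and
  the factors are \<open>F \<circ> t\<close> and \<open>inv t\<close>.\<close>

lemma ex_blockwise_factors:
  assumes F: "bij F"
  shows "\<exists>f g. blockwise f \<and> blockwise g \<and> F = f \<circ> g"
proof -
  have "\<exists>b>a. F ` {..<a} \<subseteq> {..<b} \<and> inv F ` {..<a} \<subseteq> {..<b}" for a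
  proof -
    obtain b where "\<forall>x\<in>F ` {..<a} \<union> inv F ` {..<a} \<union> {a}. x < b"
      using finite_nat_set_iff_bounded[of "F ` {..<a} \<union> inv F ` {..<a} \<union> {a}"] by auto
    then show ?thesis by (intro exI[of _ b]) auto
  qed
  then have "\<exists>a :: nat \<Rightarrow> nat. \<forall>i. a (Suc i) > a i \<and> F ` {..<a i} \<subseteq> {..<a (Suc i)} \<and>
      inv F ` {..<a i} \<subseteq> {..<a (Suc i)}"
    using dependent_nat_choice[of "\<lambda>_ _. True"
      "\<lambda>_ a b. a < b \<and> F ` {..<a} \<subseteq> {..<b} \<and> inv F ` {..<a} \<subseteq> {..<b}"] by auto
  then obtain a :: "nat \<Rightarrow> nat" where a: "\<And>i. a i < a (Suc i)"
    "\<And>i. F ` {..<a i} \<subseteq> {..<a (Suc i)}" "\<And>i. inv F ` {..<a i} \<subseteq> {..<a (Suc i)}"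
    by blast
  have ge: "i \<le> a i" for i
    using a(1) by (intro seq_suble) (simp add: strict_mono_Suc_iff)
  have FF: "F (inv F x) = x" "inv F (F x) = x" for x
    using F by (simp_all add: bij_is_inj bij_is_surj surj_f_inv_f)
  txt \<open>If \<open>t\<close> maps the chain \<open>S\<close> to \<open>S'\<close>, then \<open>t\<close> preserves the even and \<open>F \<circ> t\<close> the odd terms of \<open>S\<close>.\<close>
  define S where "S i = {..<a i}" for i
  define S' where "S' i = (if even i then {..<a i} else inv F ` {..<a i})" for i
  have exh: "x \<in> S (Suc x)" for x using ge[of "Suc x"] by (auto simp: S_def)
  have step: "S i \<subseteq> S' (Suc i)" "S' i \<subseteq> S (Suc i)" "S' i \<subseteq> S' (Suc i)" for i
  proof -
    have "{..<a i} \<subseteq> inv F ` {..<a (Suc i)}"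
    proof
      fix x assume "x \<in> {..<a i}"
      then have "F x \<in> {..<a (Suc i)}" using a(2)[of i] by blast
      then show "x \<in> inv F ` {..<a (Suc i)}" using FF(2)[of x] by force
    qed
    then show "S i \<subseteq> S' (Suc i)" "S' i \<subseteq> S (Suc i)" "S' i \<subseteq> S' (Suc i)"
      using a(1,3)[of i] by (auto simp: S_def S'_def)
  qed
  have inj: "inj (inv F)" using F by (simp add: bij_imp_bij_inv bij_is_inj)
  have "\<exists>t. bij t \<and> (\<forall>i. t ` S i = S' i)"
  proof (rule ex_bij_chains)
    show "incseq S" using a(1) by (auto simp: incseq_Suc_iff S_def less_imp_le)
    show "incseq S'" using step(3) by (simp add: incseq_Suc_iff)
    show "(\<Union>i. S i) = UNIV" using exh by auto
    show "(\<Union>i. S' i) = UNIV" using exh step(1) by blast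
    show "card (S i) = card (S' i)" for i
      using inj_on_subset[OF inj subset_UNIV] by (simp add: S_def S'_def card_image)
  qed (auto simp: S_def S'_def)
  then obtain t where t: "bij t" "\<And>i. t ` S i = S' i" by blast
  have "blockwise (F \<circ> t)" unfolding blockwise_def
  proof (intro conjI allI)
    show "bij (F \<circ> t)" using F t(1) by (intro bij_comp)
    fix m
    have "(F \<circ> t) ` S (2 * m + 1) = F ` S' (2 * m + 1)" by (metis t(2) image_comp)
    also have "\<dots> = S (2 * m + 1)" using FF by (simp add: S_def S'_def image_image)
    finally show "\<exists>a>m. (F \<circ> t) ` {..<a} = {..<a}"
      using ge[of "2 * m + 1"] by (intro exI[of _ "a (2 * m + 1)"]) (auto simp: S_def)
  qed
  moreover have "blockwise (inv t)" unfolding blockwise_def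
  proof (intro conjI allI)
    show "bij (inv t)" using t(1) by (rule bij_imp_bij_inv)
    fix m
    \<comment> \<open>An index of \<open>2 * m\<close> would fail to exceed \<open>m\<close> for
      \<open>m = 0\<close>.\<close>
    have "t ` S (2 * m + 2) = S (2 * m + 2)" using t(2) by (simp add: S_def S'_def)
    then have "inv t ` S (2 * m + 2) = S (2 * m + 2)"
      using t(1) by (metis bij_is_inj inv_f_f image_inv_f_f)
    then show "\<exists>a>m. inv t ` {..<a} = {..<a}"
      using ge[of "2 * m + 2"] by (intro exI[of _ "a (2 * m + 2)"]) (auto simp: S_def)
  qed
  moreover have "F = (F \<circ> t) \<circ> inv t"
    using t(1) by (simp add: fun_eq_iff bij_is_surj surj_f_inv_f)
  ultimately show ?thesis by blast
qed

subsection \<open>Labels\<close>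

text \<open>A label lists the values of a permutation of \<open>{..<e}\<close> on consecutive nonempty invariant
  intervals; its parent in the tree is \<^const>\<open>butlast\<close>.\<close>

definition labels :: "nat \<Rightarrow> nat list list set" where
  "labels e = {c. [] \<notin> set c \<and> length (concat c) = e \<and>
    (\<forall>i\<le>length c. set (concat (take i c)) = {..<length (concat (take i c))})}"

text \<open>The first position of the last block, and also the level of the parent; it is 0 for the
  empty label.\<close>

abbreviation start :: "nat list list \<Rightarrow> nat" where
  "start c \<equiv> length (concat (butlast c))"

text \<open>Blocks are nonempty, so there are at most \<open>e\<close> of them, each of length at
  most \<open>e\<close> with entries below \<open>e\<close>. Finiteness lets a whole level be
  treated in one stage.\<close>

lemma finite_labels: "finite (labels e)"
proof -
  let ?B = "{xs :: nat list. set xs \<subseteq> {..<e} \<and> length xs \<le> e}"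
  have le: "length c \<le> length (concat c)" if "[] \<notin> set c" for c :: "nat list list"
    using that
  proof (induction c)
    case (Cons xs c)
    then have "length xs > 0" "length c \<le> length (concat c)" by auto
    then show ?case by (simp only: concat.simps length_append list.size)
  qed simp
  have "labels e \<subseteq> {c. set c \<subseteq> ?B \<and> length c \<le> e}"
  proof
    fix c assume c: "c \<in> labels e"
    then have s: "length (concat c) = e" "[] \<notin> set c"
      and "set (concat (take (length c) c)) = {..<length (concat (take (length c) c))}"
      unfolding labels_def by blast+
    then have s': "set (concat c) = {..<e}" by (simp del: set_concat)
    have "xs \<in> ?B" if "xs \<in> set c" for xs
    proof -
      have "set xs \<subseteq> set (concat c)" using that by auto
      moreover have "length xs \<le> length (concat c)"
        using that by (auto simp: length_concat intro!: member_le_sum_list)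
      ultimately show ?thesis unfolding s s' by simp
    qed
    moreover have "length c \<le> e" using le[OF s(2)] unfolding s(1) .
    ultimately show "c \<in> {c. set c \<subseteq> ?B \<and> length c \<le> e}" by blast
  qed
  moreover have "finite {c. set c \<subseteq> ?B \<and> length c \<le> e}"
    by (intro finite_lists_length_le) auto
  ultimately show ?thesis by (rule finite_subset)
qed

lemma labels_length: "c \<in> labels e \<Longrightarrow> length (concat c) = e"
  by (simp add: labels_def)

lemma butlast_labels:
  assumes "c \<in> labels e" "c \<noteq> []"
  shows "butlast c \<in> labels (start c)" "start c < e"
proof -
  obtain d xs where c: "c = d @ [xs]" using assms(2) by (cases c rule: rev_cases) auto
  have *: "[] \<notin> set c" "length (concat c) = e"
    "\<And>i. i \<le> length c \<Longrightarrow> set (concat (take i c)) = {..<length (concat (take i c))}"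
    using assms(1) unfolding labels_def by blast+
  have "set (concat (take i d)) = {..<length (concat (take i d))}" if "i \<le> length d" for i
    using *(3)[of i] that c by (simp del: set_concat)
  then show "butlast c \<in> labels (start c)"
    using *(1) c by (simp add: labels_def del: set_concat)
  show "start c < e" using *(1,2) c by auto
qed

text \<open>Only positions in the last block count; those in earlier blocks are left to the
  ancestors of \<open>c\<close>, whose values there are inherited.\<close>

definition slots :: "(nat list list \<times> nat) set" where
  "slots = {(c, n). c \<in> labels (length (concat c)) \<and> start c \<le> n \<and> n < length (concat c)}"

definition slot_perm :: "nat list list \<times> nat \<Rightarrow> nat list list \<times> nat" where
  "slot_perm = (\<lambda>(c, n). (c, concat c ! n))"

text \<open>\<open>concat c\<close> permutes all its positions, and its restriction to the positions
  of \<open>butlast c\<close> permutes those; hence it permutes the difference.\<close>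

lemma bij_betw_nth_interval:
  assumes "c \<in> labels (length (concat c))"
  shows "bij_betw ((!) (concat c)) {start c..<length (concat c)} {start c..<length (concat c)}"
proof (cases c rule: rev_cases)
  case (snoc d xs)
  let ?m = "length (concat d)"
  have full: "set (concat (take i c)) = {..<length (concat (take i c))}" if "i \<le> length c" for i
    using assms that unfolding labels_def by blast
  have d: "set (concat d) = {..<?m}" using full[of "length d"] snoc by (simp del: set_concat)
  have c: "set (concat c) = {..<length (concat c)}" using full[of "length c"] by (simp del: set_concat)
  have "distinct (concat c)" by (rule card_distinct) (simp add: c del: set_concat)
  then have bij: "bij_betw ((!) (concat c)) {..<length (concat c)} {..<length (concat c)}"
    by (rule bij_betw_nth[OF _ refl c[symmetric]])
  have "distinct (concat d)" by (rule card_distinct) (simp add: d del: set_concat)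
  then have "bij_betw ((!) (concat d)) {..<?m} {..<?m}"
    by (rule bij_betw_nth[OF _ refl d[symmetric]])
  then have bijd: "bij_betw ((!) (concat c)) {..<?m} {..<?m}"
    by (rule bij_betw_cong[THEN iffD1, rotated]) (use snoc in \<open>simp add: nth_append\<close>)
  have "{start c..<length (concat c)} = {..<length (concat c)} - {..<?m}" using snoc by auto
  then show ?thesis
    using bij_betw_DiffI[OF bij bijd] snoc by simp
qed (simp add: bij_betw_def)

lemma bij_betw_slot_perm: "bij_betw slot_perm slots slots"
proof -
  have into: "slot_perm z \<in> slots" if "z \<in> slots" for z
  proof -
    obtain c n where z: "z = (c, n)" by fastforce
    with that have c: "c \<in> labels (length (concat c))" "n \<in> {start c..<length (concat c)}"
      by (auto simp: slots_def)
    then have "concat c ! n \<in> {start c..<length (concat c)}"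
      using bij_betwE[OF bij_betw_nth_interval] by blast
    with c z show ?thesis by (simp add: slots_def slot_perm_def)
  qed
  moreover have "inj_on slot_perm slots"
  proof (rule inj_onI)
    fix z z' assume z: "z \<in> slots" "z' \<in> slots" "slot_perm z = slot_perm z'"
    obtain c n n' where zz: "z = (c, n)" "z' = (c, n')" "concat c ! n = concat c ! n'"
      using z(3) by (cases z, cases z') (auto simp: slot_perm_def)
    with z have "c \<in> labels (length (concat c))" "n \<in> {start c..<length (concat c)}"
      "n' \<in> {start c..<length (concat c)}" by (auto simp: slots_def)
    then have "n = n'" using zz(3) bij_betw_imp_inj_on[OF bij_betw_nth_interval]
      by (metis inj_onD)
    then show "z = z'" using zz by simp
  qed
  moreover have "z \<in> slot_perm ` slots" if "z \<in> slots" for z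
  proof -
    obtain c n where z: "z = (c, n)" by fastforce
    with that have c: "c \<in> labels (length (concat c))" "n \<in> {start c..<length (concat c)}"
      by (auto simp: slots_def)
    then obtain m where "m \<in> {start c..<length (concat c)}" "concat c ! m = n"
      using bij_betw_imp_surj_on[OF bij_betw_nth_interval[OF c(1)]] by (metis imageE)
    with c z show ?thesis by (intro image_eqI[of _ _ "(c, m)"]) (auto simp: slots_def slot_perm_def)
  qed
  ultimately show ?thesis by (auto simp: bij_betw_def)
qed

text \<open>Injectivity of \<open>b\<close> lets a single permutation fulfil the prescriptions of
  all slots at once; it is the identity off the image of \<open>b\<close>.\<close>

lemma ex_bij_transport:
  assumes b: "inj_on b B" and \<pi>: "bij_betw \<pi> B B"
  shows "\<exists>W. bij W \<and> (\<forall>z\<in>B. W (b z) = b (\<pi> z))"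
proof -
  define W where "W y = (if y \<in> b ` B then b (\<pi> (inv_into B b y)) else y)" for y
  have W: "W (b z) = b (\<pi> z)" if "z \<in> B" for z
    using that b by (simp add: W_def)
  have bB: "bij_betw b B (b ` B)" using b by (simp add: bij_betw_def)
  have "bij_betw (b \<circ> \<pi> \<circ> inv_into B b) (b ` B) (b ` B)"
    by (rule bij_betw_trans[OF bij_betw_inv_into[OF bB] bij_betw_trans[OF \<pi> bB]])
  then have 1: "bij_betw W (b ` B) (b ` B)"
    by (rule bij_betw_cong[THEN iffD1, rotated]) (simp add: W_def)
  have "bij_betw id (- b ` B) (- b ` B)" by simp
  then have 2: "bij_betw W (- b ` B) (- b ` B)"
    by (rule bij_betw_cong[THEN iffD1, rotated]) (simp add: W_def)
  have "bij W" using bij_betw_combine[OF 1 2] by simp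
  with W show ?thesis by blast
qed

subsection \<open>The tree of partial permutations\<close>

lemma infinite_orbit_notin:
  assumes "infinite (orbit (pstab G \<Gamma>) \<alpha>)"
  shows "\<alpha> \<notin> \<Gamma>"
proof
  assume "\<alpha> \<in> \<Gamma>"
  then have "orbit (pstab G \<Gamma>) \<alpha> \<subseteq> {\<alpha>}" by (auto simp: orbit_def pstab_def)
  with assms show False using finite_subset by blast
qed

text \<open>Points are treated one at a time. Composing \<open>q\<close> with \<open>h\<close> from
  the stabilizer of \<open>\<Gamma> e\<close> keeps the values on \<open>\<Gamma> a\<close> and at
  the earlier \<open>\<alpha> n\<close>, while \<open>h (\<alpha> e)\<close> can be any point of an
  infinite orbit, so its image under \<open>q\<close> can avoid \<open>X\<close>.\<close>

lemma ex_extension_avoiding: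
  fixes a e :: nat
  assumes G: "is_sym_subgroup G" and "p \<in> G" "finite X" and "a \<le> e"
    and "\<And>n. a \<le> n \<Longrightarrow> n < e \<Longrightarrow> infinite (orbit (pstab G (\<Gamma> n)) (\<alpha> n))"
    and "\<And>m n. a \<le> m \<Longrightarrow> m < n \<Longrightarrow> n < e \<Longrightarrow> \<Gamma> m \<subseteq> \<Gamma> n \<and> \<alpha> m \<in> \<Gamma> n"
  shows "\<exists>q\<in>G. (\<forall>\<gamma>\<in>\<Gamma> a. q \<gamma> = p \<gamma>) \<and> (\<forall>n\<in>{a..<e}. q (\<alpha> n) \<notin> X)"
  using assms(4-)
proof (induction e rule: dec_induct)
  case base
  then show ?case using assms(2) by auto
next
  case (step e)
  have IH: "\<exists>q\<in>G. (\<forall>\<gamma>\<in>\<Gamma> a. q \<gamma> = p \<gamma>) \<and> (\<forall>n\<in>{a..<e}. q (\<alpha> n) \<notin> X)"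
    by (rule step.IH) (use step.prems in \<open>auto simp: less_Suc_eq\<close>)
  then obtain q where q: "q \<in> G" "\<And>\<gamma>. \<gamma> \<in> \<Gamma> a \<Longrightarrow> q \<gamma> = p \<gamma>"
    "\<And>n. n \<in> {a..<e} \<Longrightarrow> q (\<alpha> n) \<notin> X" by auto
  have inf: "infinite (orbit (pstab G (\<Gamma> e)) (\<alpha> e))" using step by simp
  have "inj q" using sym_subgroupD(1)[OF G q(1)] by (rule bij_is_inj)
  then have "infinite (q ` orbit (pstab G (\<Gamma> e)) (\<alpha> e))"
    using inf finite_imageD inj_on_subset by blast
  then obtain y where "y \<in> orbit (pstab G (\<Gamma> e)) (\<alpha> e)" "q y \<notin> X"
    using assms(3) by (meson finite_subset image_subsetI)
  then obtain h where h: "h \<in> G" "\<And>\<gamma>. \<gamma> \<in> \<Gamma> e \<Longrightarrow> h \<gamma> = \<gamma>" "q (h (\<alpha> e)) \<notin> X"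
    by (auto simp: orbit_def pstab_def)
  have "\<Gamma> a \<subseteq> \<Gamma> e" using step.prems(2)[of a e] step.hyps by (cases "a = e") auto
  moreover have "\<alpha> n \<in> \<Gamma> e" if "n \<in> {a..<e}" for n using step.prems(2)[of n e] that by auto
  ultimately show ?case using q h sym_subgroupD(3)[OF G]
    by (intro bexI[of _ "q \<circ> h"]) (auto simp: less_Suc_eq)
qed

text \<open>Greedy choice: \<open>ex\<close> holds for every finite \<open>X\<close>, so the values
  already used can be added to the set to be avoided.\<close>

lemma ex_choice_avoiding:
  assumes "finite L" "finite X" and "\<And>c q. finite (v c q)"
    and ex: "\<And>c X. c \<in> L \<Longrightarrow> finite X \<Longrightarrow> \<exists>q. R c q \<and> v c q \<inter> X = {}"
  shows "\<exists>p. \<forall>c\<in>L. R c (p c) \<and> v c (p c) \<inter> X = {} \<and>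
    (\<forall>d\<in>L. c \<noteq> d \<longrightarrow> v c (p c) \<inter> v d (p d) = {})"
  using assms(1) ex
proof (induction L rule: finite_induct)
  case (insert c L)
  have "\<exists>p. \<forall>d\<in>L. R d (p d) \<and> v d (p d) \<inter> X = {} \<and>
    (\<forall>d'\<in>L. d \<noteq> d' \<longrightarrow> v d (p d) \<inter> v d' (p d') = {})"
    by (rule insert.IH) (rule insert.prems, auto)
  then obtain p where p: "\<And>d. d \<in> L \<Longrightarrow> R d (p d)" "\<And>d. d \<in> L \<Longrightarrow> v d (p d) \<inter> X = {}"
    "\<And>d d'. d \<in> L \<Longrightarrow> d' \<in> L \<Longrightarrow> d \<noteq> d' \<Longrightarrow> v d (p d) \<inter> v d' (p d') = {}" by metis
  have "finite (X \<union> (\<Union>d\<in>L. v d (p d)))" using insert.hyps assms(2,3) by simp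
  from insert.prems[OF insertI1 this] obtain q
    where q: "R c q" "v c q \<inter> (X \<union> (\<Union>d\<in>L. v d (p d))) = {}" by auto
  then have q': "v c q \<inter> v d (p d) = {}" "v d (p d) \<inter> v c q = {}" if "d \<in> L" for d
    using that by auto
  define p' where "p' d = (if d = c then q else p d)" for d
  have p': "p' c = q" "\<And>d. d \<in> L \<Longrightarrow> p' d = p d" using insert.hyps(2) by (auto simp: p'_def)
  show ?case
    by (rule exI[of _ p']) (use p q q' in \<open>auto simp: p' simp del: disjoint_iff\<close>)
qed simp

text \<open>Stage \<open>e\<close> chooses \<open>\<Gamma> e\<close>, \<open>\<alpha> e\<close> and
  all \<open>p c\<close> with \<open>c\<close> in \<open>labels e\<close>. Values on
  \<open>\<Gamma> e\<close> are frozen for all descendants. With \<open>x\<close> an enumeration of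
  the universe, the conditions on \<open>x\<close> make limits along branches defined everywhere and
  surjective; the last conclusion is what defines \<open>W\<close>.\<close>

lemma ex_tree:
  fixes G :: "('a \<Rightarrow> 'a) set" and x :: "nat \<Rightarrow> 'a"
  assumes G: "is_sym_subgroup G"
    and orb: "\<And>\<Gamma>. finite \<Gamma> \<Longrightarrow> \<exists>\<alpha>. infinite (orbit (pstab G \<Gamma>) \<alpha>)"
  obtains \<Gamma> :: "nat \<Rightarrow> 'a set" and \<alpha> :: "nat \<Rightarrow> 'a" and p :: "nat list list \<Rightarrow> 'a \<Rightarrow> 'a"
  where "inj \<alpha>"
    and "\<And>m e. m < e \<Longrightarrow> \<Gamma> m \<subseteq> \<Gamma> e \<and> \<alpha> m \<in> \<Gamma> e \<and> x m \<in> \<Gamma> e"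
    and "\<And>c e. c \<in> labels e \<Longrightarrow> p c \<in> G"
    and "\<And>c e j. c \<in> labels e \<Longrightarrow> j < e \<Longrightarrow> inv (p c) (x j) \<in> \<Gamma> e"
    and "\<And>c e \<gamma>. c \<in> labels e \<Longrightarrow> c \<noteq> [] \<Longrightarrow> \<gamma> \<in> \<Gamma> (start c) \<Longrightarrow> p c \<gamma> = p (butlast c) \<gamma>"
    and "inj_on (\<lambda>(c, n). p c (\<alpha> n)) slots"
proof -
  let ?\<Gamma> = "\<lambda>h m. fst (h m)" and ?\<alpha> = "\<lambda>h m. fst (snd (h m))" and ?p = "\<lambda>h m. snd (snd (h m))"
  \<comment> \<open>The detour through \<open>m < e\<close> with \<open>start c = m\<close> makes
    \<open>P h e r\<close> depend only on \<open>h\<close> below \<open>e\<close>, as the recursion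
    principle requires.\<close>
  define P where "P h e r \<longleftrightarrow> (case r of (\<Gamma>, \<alpha>, p) \<Rightarrow>
    finite \<Gamma> \<and> infinite (orbit (pstab G \<Gamma>) \<alpha>) \<and>
    (\<forall>m<e. ?\<Gamma> h m \<subseteq> \<Gamma> \<and> ?\<alpha> h m \<in> \<Gamma> \<and> x m \<in> \<Gamma>) \<and>
    (\<forall>c\<in>labels e. p c \<in> G \<and> (\<forall>j<e. inv (p c) (x j) \<in> \<Gamma>) \<and>
      (\<forall>m<e. start c = m \<longrightarrow> (\<forall>\<gamma>\<in>?\<Gamma> h m. p c \<gamma> = ?p h m (butlast c) \<gamma>)) \<and>
      (\<forall>m<e. \<forall>d\<in>labels m. \<forall>n<e. \<forall>k<m. start c \<le> n \<longrightarrow> p c (?\<alpha> h n) \<noteq> ?p h m d (?\<alpha> h k)) \<and>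
      (\<forall>d\<in>labels e. c \<noteq> d \<longrightarrow> (\<forall>n<e. \<forall>k<e. start c \<le> n \<longrightarrow> start d \<le> k \<longrightarrow>
        p c (?\<alpha> h n) \<noteq> p d (?\<alpha> h k)))))"
    for h :: "nat \<Rightarrow> 'a set \<times> 'a \<times> (nat list list \<Rightarrow> 'a \<Rightarrow> 'a)" and e r
  have "\<exists>h. \<forall>e. P h e (h e)"
  proof (rule dependent_wellorder_choice)
    fix e r and f g :: "nat \<Rightarrow> 'a set \<times> 'a \<times> (nat list list \<Rightarrow> 'a \<Rightarrow> 'a)"
    assume "\<And>y. y < e \<Longrightarrow> f y = g y"
    then show "P f e r = P g e r" by (simp add: P_def cong: conj_cong)
  next
    fix e and h :: "nat \<Rightarrow> 'a set \<times> 'a \<times> (nat list list \<Rightarrow> 'a \<Rightarrow> 'a)"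
    assume prev: "\<And>y. y < e \<Longrightarrow> P h y (h y)"
    define v where "v c q = (\<lambda>n. q (?\<alpha> h n)) ` {start c..<e}" for c and q :: "'a \<Rightarrow> 'a"
    define R where "R c q \<longleftrightarrow> q \<in> G \<and>
      (\<forall>m<e. start c = m \<longrightarrow> (\<forall>\<gamma>\<in>?\<Gamma> h m. q \<gamma> = ?p h m (butlast c) \<gamma>))" for c q
    \<comment> \<open>All values taken at lower levels, ancestors included; a finite set since the
      levels are finite.\<close>
    define X where "X = (\<Union>m<e. \<Union>d\<in>labels m. (\<lambda>k. ?p h m d (?\<alpha> h k)) ` {..<m})"
    have ex: "\<exists>q. R c q \<and> v c q \<inter> Y = {}" if c: "c \<in> labels e" and Y: "finite Y" for c Y
    proof (cases "c = []")
      case True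
      \<comment> \<open>At the root there is no parent to extend and no value to choose, so
        \<open>id\<close> serves.\<close>
      then have "e = 0" using labels_length[OF c] by simp
      then show ?thesis using sym_subgroupD(2)[OF G] by (auto simp: R_def v_def)
    next
      case False
      note b = butlast_labels[OF c False]
      have "?p h (start c) (butlast c) \<in> G"
        using prev[OF b(2)] b(1) by (auto simp: P_def split: prod.splits)
      moreover have "infinite (orbit (pstab G (?\<Gamma> h n)) (?\<alpha> h n))" if "n < e" for n
        using prev[OF that] by (auto simp: P_def split: prod.splits)
      moreover have "?\<Gamma> h m \<subseteq> ?\<Gamma> h n \<and> ?\<alpha> h m \<in> ?\<Gamma> h n" if "m < n" "n < e" for m n
        using prev[OF that(2)] that(1) by (auto simp: P_def split: prod.splits)
      ultimately obtain q where "q \<in> G" "\<forall>\<gamma>\<in>?\<Gamma> h (start c). q \<gamma> = ?p h (start c) (butlast c) \<gamma>"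
        "\<forall>n\<in>{start c..<e}. q (?\<alpha> h n) \<notin> Y"
        using ex_extension_avoiding[OF G _ Y less_imp_le[OF b(2)], of "?p h (start c) (butlast c)" "?\<Gamma> h" "?\<alpha> h"]
        by blast
      then show ?thesis by (intro exI[of _ q]) (auto simp: R_def v_def)
    qed
    have "finite X" by (auto simp: X_def finite_labels)
    txt \<open>All \<open>p c\<close> at level \<open>e\<close> are chosen before \<open>\<Gamma>\<close>, which has to contain preimages under them:
      this makes the limits along branches surjective.\<close>
    have "\<exists>p. \<forall>c\<in>labels e. R c (p c) \<and> v c (p c) \<inter> X = {} \<and>
      (\<forall>d\<in>labels e. c \<noteq> d \<longrightarrow> v c (p c) \<inter> v d (p d) = {})"
      by (rule ex_choice_avoiding[OF finite_labels \<open>finite X\<close> _ ex]) (auto simp: v_def)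
    then obtain p where p: "\<And>c. c \<in> labels e \<Longrightarrow> R c (p c)"
      "\<And>c. c \<in> labels e \<Longrightarrow> v c (p c) \<inter> X = {}"
      "\<And>c d. c \<in> labels e \<Longrightarrow> d \<in> labels e \<Longrightarrow> c \<noteq> d \<Longrightarrow> v c (p c) \<inter> v d (p d) = {}"
      by blast
    define \<Gamma> where "\<Gamma> = (\<Union>m<e. insert (?\<alpha> h m) (insert (x m) (?\<Gamma> h m))) \<union>
      (\<Union>c\<in>labels e. (\<lambda>j. inv (p c) (x j)) ` {..<e})"
    have "finite (?\<Gamma> h m)" if "m < e" for m
      using prev[OF that] by (auto simp: P_def split: prod.splits)
    then have fin: "finite \<Gamma>" by (auto simp: \<Gamma>_def finite_labels)
    obtain \<alpha> where \<alpha>: "infinite (orbit (pstab G \<Gamma>) \<alpha>)" using orb[OF fin] by blast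
    have "P h e (\<Gamma>, \<alpha>, p)"
      unfolding P_def prod.case
    proof (intro conjI ballI allI impI fin \<alpha>)
      show "?\<Gamma> h m \<subseteq> \<Gamma>" "?\<alpha> h m \<in> \<Gamma>" "x m \<in> \<Gamma>" if "m < e" for m
        using that by (auto simp: \<Gamma>_def)
      fix c assume c: "c \<in> labels e"
      show "p c \<in> G" using p(1)[OF c] by (simp add: R_def)
      show "inv (p c) (x j) \<in> \<Gamma>" if "j < e" for j using that c by (auto simp: \<Gamma>_def)
      show "p c \<gamma> = ?p h m (butlast c) \<gamma>" if "m < e" "start c = m" "\<gamma> \<in> ?\<Gamma> h m" for m \<gamma>
        using p(1)[OF c] that by (simp add: R_def)
      show "p c (?\<alpha> h n) \<noteq> ?p h m d (?\<alpha> h k)"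
        if "m < e" "d \<in> labels m" "n < e" "k < m" "start c \<le> n" for m d n k
      proof -
        have "?p h m d (?\<alpha> h k) \<in> X" using that by (auto simp: X_def)
        moreover have "p c (?\<alpha> h n) \<in> v c (p c)" using that by (auto simp: v_def)
        ultimately show ?thesis using p(2)[OF c] by (metis disjoint_iff)
      qed
      show "p c (?\<alpha> h n) \<noteq> p d (?\<alpha> h k)"
        if "d \<in> labels e" "c \<noteq> d" "n < e" "k < e" "start c \<le> n" "start d \<le> k" for d n k
      proof -
        have "p c (?\<alpha> h n) \<in> v c (p c)" "p d (?\<alpha> h k) \<in> v d (p d)" using that by (auto simp: v_def)
        then show ?thesis using p(3)[OF c that(1,2)] by (metis disjoint_iff)
      qed
    qed
    then show "\<exists>r. P h e r" ..
  qed
  then obtain h where h: "\<And>e. P h e (h e)" by blast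
  define \<Gamma> where "\<Gamma> e = ?\<Gamma> h e" for e
  define \<alpha> where "\<alpha> e = ?\<alpha> h e" for e
  \<comment> \<open>A label determines its level, so the choices of all stages merge into one
    function.\<close>
  define p where "p c = ?p h (length (concat c)) c" for c
  have orbs: "infinite (orbit (pstab G (\<Gamma> e)) (\<alpha> e))" for e
    using h[of e] by (auto simp: P_def \<Gamma>_def \<alpha>_def split: prod.splits)
  have mono: "\<Gamma> m \<subseteq> \<Gamma> e \<and> \<alpha> m \<in> \<Gamma> e \<and> x m \<in> \<Gamma> e" if "m < e" for m e
    using h[of e] that by (auto simp: P_def \<Gamma>_def \<alpha>_def split: prod.splits)
  have pG: "p c \<in> G" if "c \<in> labels e" for c e
    using h[of e] that labels_length[OF that] by (auto simp: P_def p_def split: prod.splits)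
  have protect: "inv (p c) (x j) \<in> \<Gamma> e" if "c \<in> labels e" "j < e" for c e j
    using h[of e] that labels_length[OF that(1)] by (auto simp: P_def p_def \<Gamma>_def split: prod.splits)
  have extend: "p c \<gamma> = p (butlast c) \<gamma>"
    if "c \<in> labels e" "c \<noteq> []" "\<gamma> \<in> \<Gamma> (start c)" for c e \<gamma>
    using h[of e] that labels_length[OF that(1)] butlast_labels[OF that(1,2)]
    by (auto simp: P_def p_def \<Gamma>_def split: prod.splits)
  have avoid: "p c (\<alpha> n) \<noteq> p d (\<alpha> k)"
    if "c \<in> labels e" "d \<in> labels m" "m < e" "n < e" "k < m" "start c \<le> n" for c d e m n k
    using h[of e] that labels_length[OF that(1)] labels_length[OF that(2)]
    by (auto simp: P_def p_def \<alpha>_def split: prod.splits)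
  have avoid': "p c (\<alpha> n) \<noteq> p d (\<alpha> k)"
    if "c \<in> labels e" "d \<in> labels e" "c \<noteq> d" "n < e" "k < e" "start c \<le> n" "start d \<le> k" for c d e n k
    using h[of e] that labels_length[OF that(1)] labels_length[OF that(2)]
    by (auto simp: P_def p_def \<alpha>_def split: prod.splits)
  have inj: "inj \<alpha>"
  proof -
    \<comment> \<open>\<open>\<alpha> n\<close> is not fixed by the stabilizer of
      \<open>\<Gamma> n\<close>, whereas \<open>\<alpha> m\<close> lies in
      \<open>\<Gamma> n\<close>.\<close>
    have "\<alpha> m \<noteq> \<alpha> n" if "m < n" for m n
      using mono[OF that] infinite_orbit_notin[OF orbs[of n]] by metis
    then show ?thesis by (metis injI linorder_neqE_nat)
  qed
  have "inj_on (\<lambda>(c, n). p c (\<alpha> n)) slots"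
  proof (rule inj_onI, clarify)
    fix c n d k
    assume "(c, n) \<in> slots" "(d, k) \<in> slots" and eq: "p c (\<alpha> n) = p d (\<alpha> k)"
    then have c: "c \<in> labels (length (concat c))" "start c \<le> n" "n < length (concat c)"
      and d: "d \<in> labels (length (concat d))" "start d \<le> k" "k < length (concat d)"
      by (auto simp: slots_def)
    have "length (concat c) = length (concat d)"
    proof (rule ccontr)
      assume "length (concat c) \<noteq> length (concat d)"
      then consider "length (concat c) < length (concat d)" | "length (concat d) < length (concat c)"
        by linarith
      then show False
        using avoid[OF c(1) d(1) _ c(3) d(3) c(2)] avoid[OF d(1) c(1) _ d(3) c(3) d(2)] eq
        by cases auto
    qed
    then have "c = d" using avoid'[OF c(1)] c d eq by metis
    moreover have "inj (p c)" using sym_subgroupD(1)[OF G pG[OF c(1)]] by (rule bij_is_inj)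
    ultimately show "c = d \<and> n = k" using eq inj by (metis injD)
  qed
  with inj mono pG protect extend show thesis by (rule that)
qed

subsection \<open>Limits in closed subgroups\<close>

text \<open>Membership in a subbasic set depends on one value, and finite intersections and unions
  keep the dependence finite near each \<open>g\<close>.\<close>

lemma openin_sym_topologyD:
  assumes "openin sym_topology V" "g \<in> V"
  shows "\<exists>X. finite X \<and> (\<forall>q. bij q \<longrightarrow> (\<forall>x\<in>X. q x = g x) \<longrightarrow> q \<in> V)"
proof -
  have "generate_topology_on {{f \<in> Sym. f \<alpha> = \<beta>} | \<alpha> \<beta>. True} V"
    using assms(1) unfolding sym_topology_def openin_topology_generated_by_iff .
  then show ?thesis using assms(2)
  proof (induction arbitrary: g rule: generate_topology_on.induct)
    case Empty
    then show ?case by simp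
  next
    case (Int V V')
    from Int.IH(1)[of g] Int.prems obtain X where X: "finite X"
      "\<And>q. bij q \<Longrightarrow> \<forall>x\<in>X. q x = g x \<Longrightarrow> q \<in> V" by auto
    from Int.IH(2)[of g] Int.prems obtain X' where X': "finite X'"
      "\<And>q. bij q \<Longrightarrow> \<forall>x\<in>X'. q x = g x \<Longrightarrow> q \<in> V'" by auto
    show ?case by (rule exI[of _ "X \<union> X'"]) (use X X' in simp)
  next
    case (UN K)
    then obtain V where V: "V \<in> K" "g \<in> V" by blast
    from UN.IH[OF this] obtain X where
      "finite X" "\<forall>q. bij q \<longrightarrow> (\<forall>x\<in>X. q x = g x) \<longrightarrow> q \<in> V" by blast
    with V(1) show ?case by (intro exI[of _ X]) blast
  next
    case (Basis V)
    then obtain \<alpha> \<beta> where "V = {f \<in> Sym. f \<alpha> = \<beta>}" by blast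
    with Basis show ?case by (intro exI[of _ "{\<alpha>}"]) (auto simp: Sym_def)
  qed
qed

lemma sym_closed_limit:
  assumes "sym_closed G" "bij g" and lim: "\<And>X. finite X \<Longrightarrow> \<exists>q\<in>G. bij q \<and> (\<forall>x\<in>X. q x = g x)"
  shows "g \<in> G"
proof (rule ccontr)
  assume "g \<notin> G"
  have "topspace sym_topology = Sym"
    unfolding sym_topology_def topology_generated_by_topspace by auto
  then have "openin sym_topology (Sym - G)"
    using assms(1) unfolding sym_closed_def closedin_def by metis
  moreover have "g \<in> Sym - G" using assms(2) \<open>g \<notin> G\<close> by (simp add: Sym_def)
  ultimately obtain X where "finite X"
    "\<forall>q. bij q \<longrightarrow> (\<forall>x\<in>X. q x = g x) \<longrightarrow> q \<in> Sym - G"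
    using openin_sym_topologyD by blast
  with lim[of X] show False by blast
qed

section \<open>Branches of the tree and the permutations they define\<close>

lemma ex_label_path:
  assumes f: "blockwise f"
  obtains c :: "nat \<Rightarrow> nat list list" and a :: "nat \<Rightarrow> nat"
  where "a 0 = 0" "strict_mono a" "\<And>i. c i \<in> labels (a i)"
    "\<And>i. c (Suc i) \<noteq> []" "\<And>i. butlast (c (Suc i)) = c i" "\<And>i n. n < a i \<Longrightarrow> concat (c i) ! n = f n"
proof -
  \<comment> \<open>The condition for \<open>i = 0\<close> makes the path start at the root.\<close>
  have "\<exists>a :: nat \<Rightarrow> nat. \<forall>i. (f ` {..<a i} = {..<a i} \<and> (i = 0 \<longrightarrow> a i = 0)) \<and> a i < a (Suc i)"
  proof (rule dependent_nat_choice)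
    fix b i :: nat
    obtain b' where "b' > b" "f ` {..<b'} = {..<b'}" using f unfolding blockwise_def by blast
    then show "\<exists>b'. (f ` {..<b'} = {..<b'} \<and> (Suc i = 0 \<longrightarrow> b' = 0)) \<and> b < b'" by auto
  qed auto
  then obtain a where a: "\<And>i. f ` {..<a i} = {..<a i}" "a 0 = 0" "\<And>i. a i < a (Suc i)" by metis
  \<comment> \<open>\<open>c i\<close> lists the first \<open>i\<close> blocks of \<open>f\<close>,
    cut at the invariant segments \<open>a j\<close>.\<close>
  define c where "c i = map (\<lambda>j. map f [a j..<a (Suc j)]) [0..<i]" for i
  have cc: "concat (c i) = map f [0..<a i]" for i
  proof (induction i)
    case 0
    then show ?case by (simp add: c_def a(2))
  next
    case (Suc i)
    have "c (Suc i) = c i @ [map f [a i..<a (Suc i)]]" by (simp add: c_def)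
    moreover have "[0..<a (Suc i)] = [0..<a i] @ [a i..<a (Suc i)]"
      using upt_add_eq_append[of 0 "a i" "a (Suc i) - a i"] a(3)[of i] by simp
    ultimately show ?case using Suc by simp
  qed
  have take: "take j (c i) = c j" if "j \<le> i" for i j
    using that by (simp add: c_def take_map)
  have "c i \<in> labels (a i)" for i
  proof -
    have "xs \<noteq> []" if xs: "xs \<in> set (c i)" for xs
    proof -
      from xs obtain j where "xs = map f [a j..<a (Suc j)]" unfolding c_def set_map by blast
      then show ?thesis using a(3)[of j] by simp
    qed
    then have "[] \<notin> set (c i)" by blast
    moreover have "set (concat (take j (c i))) = {..<length (concat (take j (c i)))}"
      if "j \<le> length (c i)" for j
      using that a(1)[of j] by (simp add: take cc c_def[of i] lessThan_atLeast0 del: set_concat)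
        (simp add: take[unfolded c_def] cc[unfolded c_def] lessThan_atLeast0 del: set_concat)
    ultimately show ?thesis by (simp add: labels_def cc del: set_concat)
  qed
  moreover have "strict_mono a" using a(3) by (simp add: strict_mono_Suc_iff)
  moreover have "c (Suc i) \<noteq> []" "butlast (c (Suc i)) = c i" for i by (simp_all add: c_def)
  moreover have "concat (c i) ! n = f n" if "n < a i" for i n using that by (simp add: cc)
  ultimately show thesis using a(2) that by blast
qed

lemma ex_conjugator:
  fixes G :: "('a \<Rightarrow> 'a) set"
  assumes cnt: "countable (UNIV :: 'a set)" and inf: "infinite (UNIV :: 'a set)"
    and G: "is_sym_subgroup G" "sym_closed G"
    and orb: "\<And>\<Gamma>. finite \<Gamma> \<Longrightarrow> \<exists>\<alpha>. infinite (orbit (pstab G \<Gamma>) \<alpha>)"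
  shows "\<exists>(\<alpha> :: nat \<Rightarrow> 'a) W. inj \<alpha> \<and> bij W \<and>
    (\<forall>f. blockwise f \<longrightarrow> (\<exists>g\<in>G. \<forall>n. (inv g \<circ> W \<circ> g) (\<alpha> n) = \<alpha> (f n)))"
proof -
  define x where "x = from_nat_into (UNIV :: 'a set)"
  have x: "bij x" unfolding x_def using bij_betw_from_nat_into[OF cnt inf] .
  obtain \<Gamma> \<alpha> p where inj: "inj \<alpha>"
    and mono: "\<And>m e. m < e \<Longrightarrow> \<Gamma> m \<subseteq> \<Gamma> e \<and> \<alpha> m \<in> \<Gamma> e \<and> x m \<in> \<Gamma> e"
    and pG: "\<And>c e. c \<in> labels e \<Longrightarrow> p c \<in> G"
    and protect: "\<And>c e j. c \<in> labels e \<Longrightarrow> j < e \<Longrightarrow> inv (p c) (x j) \<in> \<Gamma> e"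
    and extend: "\<And>c e \<gamma>. c \<in> labels e \<Longrightarrow> c \<noteq> [] \<Longrightarrow> \<gamma> \<in> \<Gamma> (start c) \<Longrightarrow> p c \<gamma> = p (butlast c) \<gamma>"
    and injb: "inj_on (\<lambda>(c, n). p c (\<alpha> n)) slots"
    by (rule ex_tree[OF G(1) orb, where x = x], assumption) (rule that)
  obtain W where W: "bij W" "\<And>c n. (c, n) \<in> slots \<Longrightarrow> W (p c (\<alpha> n)) = p c (\<alpha> (concat c ! n))"
  proof -
    from ex_bij_transport[OF injb bij_betw_slot_perm] obtain W where W: "bij W"
      "\<forall>z\<in>slots. W (case z of (c, n) \<Rightarrow> p c (\<alpha> n)) = (case slot_perm z of (c, n) \<Rightarrow> p c (\<alpha> n))"
      by blast
    show thesis
    proof (rule that[OF W(1)])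
      fix c n assume "(c, n) \<in> slots"
      from bspec[OF W(2) this] show "W (p c (\<alpha> n)) = p c (\<alpha> (concat c ! n))"
        by (simp add: slot_perm_def)
    qed
  qed
  have "\<exists>g\<in>G. \<forall>n. (inv g \<circ> W \<circ> g) (\<alpha> n) = \<alpha> (f n)" if f: "blockwise f" for f
  proof -
    obtain c a where a: "a 0 = 0" "strict_mono a" and c: "\<And>i. c i \<in> labels (a i)"
      "\<And>i. c (Suc i) \<noteq> []" "\<And>i. butlast (c (Suc i)) = c i" "\<And>i n. n < a i \<Longrightarrow> concat (c i) ! n = f n"
      by (rule ex_label_path[OF f]) (rule that)
    define q where "q i = p (c i)" for i
    have bq: "bij (q i)" for i unfolding q_def by (rule sym_subgroupD(1)[OF G(1) pG[OF c(1)]])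
    have len: "length (concat (c i)) = a i" for i using labels_length[OF c(1)] .
    have \<Gamma>_mono: "\<Gamma> (a i) \<subseteq> \<Gamma> (a k)" if "i \<le> k" for i k
      using mono[of "a i" "a k"] strict_mono_less[OF a(2), of i k] that by (cases "i = k") auto
    have q_Suc: "q (Suc i) y = q i y" if "y \<in> \<Gamma> (a i)" for i y
      using extend[OF c(1,2), of y i] that c(3) len by (simp add: q_def)
    have q_le: "q k y = q i y" if "i \<le> k" "y \<in> \<Gamma> (a i)" for i k y
      using that(1)
    proof (induction k rule: dec_induct)
      case (step k)
      then show ?case using q_Suc[of y k] \<Gamma>_mono[of i k] that(2) by auto
    qed simp
    have ge: "i \<le> a i" for i using a(2) by (rule seq_suble)
    define ix where "ix = inv x"
    have xin: "y \<in> \<Gamma> (a i)" if "ix y < i" for y i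
    proof -
      have "x (ix y) \<in> \<Gamma> (a i)" using mono[of "ix y" "a i"] ge[of i] that by simp
      then show ?thesis using x by (simp add: ix_def bij_is_surj surj_f_inv_f)
    qed
    \<comment> \<open>The pointwise limit of the \<open>q i\<close>: since
      \<open>i \<le> a i\<close>, the point \<open>y\<close> belongs to
      \<open>\<Gamma> (a i)\<close> as soon as \<open>ix y < i\<close>, and its image no longer
      changes.\<close>
    define g where "g y = q (Suc (ix y)) y" for y
    have g: "g y = q i y" if "y \<in> \<Gamma> (a i)" for y i
      using q_le[of i "max i (Suc (ix y))" y] q_le[of "Suc (ix y)" "max i (Suc (ix y))" y]
        that xin[of y "Suc (ix y)"] by (simp add: g_def)
    have "inj g"
    proof (rule injI)
      fix y z assume e: "g y = g z"
      define i where "i = Suc (max (ix y) (ix z))"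
      have "ix y < i" "ix z < i" by (simp_all add: i_def)
      then have "q i y = q i z" using e g[OF xin, of y i] g[OF xin, of z i] by simp
      then show "y = z" using bq[of i] by (meson bij_is_inj injD)
    qed
    \<comment> \<open>The preimage of \<open>z\<close> under \<open>q i\<close> was put into
      \<open>\<Gamma> (a i)\<close>, so later stages still map it to \<open>z\<close>.\<close>
    moreover have "z \<in> range g" for z
    proof -
      define i where "i = Suc (ix z)"
      define y where "y = inv (q i) z"
      have z: "z = x (ix z)" using x by (simp add: ix_def bij_is_surj surj_f_inv_f)
      have "inv (q i) (x (ix z)) \<in> \<Gamma> (a i)"
        unfolding q_def by (rule protect[OF c(1)]) (use ge[of i] in \<open>simp add: i_def\<close>)
      then have "y \<in> \<Gamma> (a i)" using z by (simp add: y_def)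
      then have "g y = q i y" by (rule g)
      then have "g y = z" using bq[of i] by (simp add: y_def bij_is_surj surj_f_inv_f)
      then show ?thesis by blast
    qed
    ultimately have bg: "bij g" by (auto simp: bij_def)
    have gG: "g \<in> G"
    proof (rule sym_closed_limit[OF G(2) bg])
      fix X :: "'a set" assume "finite X"
      then obtain i where i: "\<forall>y\<in>ix ` X. y < i" using finite_nat_set_iff_bounded by blast
      then have "\<forall>y\<in>X. q i y = g y" using g[OF xin] by auto
      moreover have "q i \<in> G" unfolding q_def by (rule pG[OF c(1)])
      ultimately show "\<exists>q\<in>G. bij q \<and> (\<forall>y\<in>X. q y = g y)" using bq by blast
    qed
    have "(inv g \<circ> W \<circ> g) (\<alpha> n) = \<alpha> (f n)" for n
    proof -
      \<comment> \<open>The least \<open>j\<close> with \<open>n < a j\<close> is a successor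
        because \<open>a 0 = 0\<close>; this finds the block containing \<open>n\<close>.\<close>
      have "\<exists>i. a i \<le> n \<and> n < a (Suc i)"
      proof -
        have "n < a (Suc n)" using ge[of "Suc n"] by simp
        then have ex: "\<exists>j. n < a j" by blast
        define j where "j = (LEAST j. n < a j)"
        have j: "n < a j" unfolding j_def using ex by (rule LeastI_ex)
        then obtain i where i: "j = Suc i" using a(1) by (cases j) auto
        then have "i < (LEAST j. n < a j)" by (simp add: j_def)
        then have "\<not> n < a i" by (rule not_less_Least)
        with i j show ?thesis by (intro exI[of _ i]) auto
      qed
      then obtain i where i: "a i \<le> n" "n < a (Suc i)" by blast
      have slot: "(c (Suc i), n) \<in> slots"
        using i c(1)[of "Suc i"] c(3)[of i] len by (simp add: slots_def del: length_concat)
      \<comment> \<open>\<open>f n\<close> stays in the block of \<open>n\<close>, so the images of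
        \<open>\<alpha> n\<close> and \<open>\<alpha> (f n)\<close> under \<open>g\<close> are both
        settled by the same node.\<close>
      have "slot_perm (c (Suc i), n) \<in> slots"
        using bij_betwE[OF bij_betw_slot_perm] slot by blast
      then have fn: "f n < a (Suc i)"
        using c(4)[OF i(2)] len by (simp add: slot_perm_def slots_def)
      have g\<alpha>: "g (\<alpha> m) = q (Suc i) (\<alpha> m)" if "m < a (Suc i)" for m
        using g mono[OF that] by blast
      have "W (g (\<alpha> n)) = g (\<alpha> (f n))"
        using W(2)[OF slot] c(4)[OF i(2)] g\<alpha>[OF i(2)] g\<alpha>[OF fn] by (simp add: q_def)
      then show ?thesis using bg by (simp add: bij_is_inj)
    qed
    with gG show ?thesis by blast
  qed
  with inj W(1) show ?thesis by blast
qed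

theorem theorem5p3:
  fixes G :: "('a \<Rightarrow> 'a) set"
  assumes "countable (UNIV :: 'a set)" and "infinite (UNIV :: 'a set)"
    and "is_sym_subgroup G" and "sym_closed G"
  shows "sym_approx G Sym \<longleftrightarrow>
    (\<forall>\<Gamma>. finite \<Gamma> \<longrightarrow> (\<exists>\<alpha>. infinite (orbit (pstab G \<Gamma>) \<alpha>)))"
proof
  assume "sym_approx G Sym"
  then have "sym_preceq Sym G" by (simp add: sym_approx_def)
  then show "\<forall>\<Gamma>. finite \<Gamma> \<longrightarrow> (\<exists>\<alpha>. infinite (orbit (pstab G \<Gamma>) \<alpha>))"
    using finite_orbits_imp_not_preceq[OF assms(1-3)] by blast
next
  assume orb: "\<forall>\<Gamma>. finite \<Gamma> \<longrightarrow> (\<exists>\<alpha>. infinite (orbit (pstab G \<Gamma>) \<alpha>))"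
  have GS: "G \<subseteq> Sym" using assms(3) by (simp add: is_sym_subgroup_def)
  obtain \<alpha> :: "nat \<Rightarrow> 'a" and W where \<alpha>: "inj \<alpha>" and W: "bij W"
    and conj: "\<And>f. blockwise f \<Longrightarrow> \<exists>g\<in>G. \<forall>n. (inv g \<circ> W \<circ> g) (\<alpha> n) = \<alpha> (f n)"
    using ex_conjugator[OF assms] orb by metis
  obtain U where U: "finite U" "U \<subseteq> Sym"
    and gen: "\<And>K. is_sym_subgroup K \<Longrightarrow> U \<subseteq> K \<Longrightarrow>
      (\<forall>F. bij F \<longrightarrow> (\<exists>q\<in>K. \<forall>n. q (\<alpha> n) = \<alpha> (F n))) \<Longrightarrow> K = Sym"
    using ex_generators_of_full_sequence[OF assms(1) \<alpha>] by metis
  \<comment> \<open>Conjugates of \<open>W\<close> by elements of \<open>G\<close> supply the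
    blockwise permutations of the sequence; \<open>U\<close> passes from the full action on the
    sequence to \<open>Sym\<close>.\<close>
  let ?U = "insert W U"
  have US: "?U \<subseteq> Sym" using U(2) W by (simp add: Sym_def)
  define K where "K = gen_subgroup (G \<union> ?U)"
  have K: "is_sym_subgroup K"
    unfolding K_def using GS US by (intro is_sym_subgroup_gen_subgroup) simp
  have sub: "G \<union> ?U \<subseteq> K" unfolding K_def by (rule gen_subgroup_superset)
  note Kc = sym_subgroupD(3)[OF K] and Ki = sym_subgroupD(4)[OF K]
  have block: "\<exists>q\<in>K. \<forall>n. q (\<alpha> n) = \<alpha> (f n)" if f: "blockwise f" for f
  proof -
    obtain g where g: "g \<in> G" "\<forall>n. (inv g \<circ> W \<circ> g) (\<alpha> n) = \<alpha> (f n)" using conj[OF f] by blast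
    then have "g \<in> K" "W \<in> K" using sub by auto
    then have "inv g \<circ> W \<circ> g \<in> K" using Kc Ki by blast
    with g(2) show ?thesis by blast
  qed
  have "K = Sym"
  proof (rule gen[OF K])
    show "U \<subseteq> K" using sub by simp
    show "\<forall>F. bij F \<longrightarrow> (\<exists>q\<in>K. \<forall>n. q (\<alpha> n) = \<alpha> (F n))"
    proof (intro allI impI)
      fix F :: "nat \<Rightarrow> nat" assume "bij F"
      then obtain f g where fg: "blockwise f" "blockwise g" "F = f \<circ> g"
        using ex_blockwise_factors by blast
      obtain q where q: "q \<in> K" "\<forall>n. q (\<alpha> n) = \<alpha> (f n)" using block[OF fg(1)] by blast
      obtain r where r: "r \<in> K" "\<forall>n. r (\<alpha> n) = \<alpha> (g n)" using block[OF fg(2)] by blast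
      have "q \<circ> r \<in> K" using q(1) r(1) by (rule Kc)
      moreover have "\<forall>n. (q \<circ> r) (\<alpha> n) = \<alpha> (F n)" using q(2) r(2) fg(3) by simp
      ultimately show "\<exists>q\<in>K. \<forall>n. q (\<alpha> n) = \<alpha> (F n)" by blast
    qed
  qed
  then have "sym_preceq Sym G"
    unfolding sym_preceq_def K_def using U(1) US by (intro exI[of _ ?U]) simp
  moreover have "sym_preceq G Sym"
    unfolding sym_preceq_def using GS gen_subgroup_superset[of "Sym \<union> {}"]
    by (intro exI[of _ "{}"]) auto
  ultimately show "sym_approx G Sym" by (simp add: sym_approx_def)
qed

end
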